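(* Let $G$ be a finite group and let $F$ be a field whose characteristic does not divide $|G|$. Let $\mathcal{L}$ be a semi-lattice of normal subgroups of $G$. Then $\{\varepsilon(\mathcal{L},H)\mid H\in\mathcal{L},\ \varepsilon(\mathcal{L},H)\neq 0\}$ is a complete set of primitive central idempotents of $S(\mathcal{L})$, and $S(\mathcal{L})\cong\bigoplus_{n}F$ (a direct sum of $n$ copies of $F$, as $F$-algebras), where $n=|\{\varepsilon(\mathcal{L},H)\mid H\in\mathcal{L},\ \varepsilon(\mathcal{L},H)\ne 0\}|$.
   Context: A semi-lattice of normal subgroups of $G$ is a set $\mathcal{L}$ of normal subgroups of $G$ that is closed under joins (products $HK$) and contains $1$ and $G$. For $A\subseteq G$ write $\overline{A}=\sum_{g\in A}g\in F[G]$, and for $H\le G$ put $\widehat{H}=\frac{1}{|H|}\overline{H}$. Define $S(\mathcal{L})=\mathrm{Span}_F\{\overline{H}\mid H\in\mathcal{L}\}$, which is a subalgebra of $F[G]$. For $H,K\in\mathcal{L}$, $K$ covers $H$ if $H<K$ and the only $L\in\mathcal{L}$ with $H\le L\le K$ are $H$ and $K$; $\mathcal{M}(\mathcal{L},H)$ is the set of covers of $H$ in $\mathcal{L}$. Define $$\varepsilon(\mathcal{L},H)=\prod_{M\in\mathcal{M}(\mathcal{L},H)}(\widehat{H}-\widehat{M})\in F[G]\quad(H\in\mathcal{L},\ H\neq G),\qquad\varepsilon(\mathcal{L},G)=\widehat{G}.$$ A central idempotent is primitive if it is nonzero and is not a sum of two nonzero central idempotents. A complete set of primitive central idempotents is the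 set of all primitive central idempotents of the (semisimple) ring (these are pairwise orthogonal with sum $1$).
   Formalization: A central idempotent is called primitive if it is nonzero and not a sum of two nonzero orthogonal central idempotents; without orthogonality the claim fails in characteristic 2 (e.g. G = C3, F = F_2, L = {1, G}), and in other characteristics orthogonality is automatic. *)

theory Defs
  imports
    "HOL-Algebra.Multiplicative_Group"
    "HOL-Algebra.QuotRing"
    "Jordan_Normal_Form.Missing_VectorSpace"
begin

text \<open>
  The group algebra of a finite group, as functions from the group to the field with
  convolution as multiplication.  For an infinite group this is not the group algebra,
  since finite support is not demanded.
\<close>

definition group_algebra ::
    "('f, 'm) ring_scheme \<Rightarrow> ('g, 'n) monoid_scheme \<Rightarrow> ('f, 'g \<Rightarrow> 'f) module" where
  "group_algebra F G =
    \<lparr>carrier = carrier G \<rightarrow>\<^sub>E carrier F,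
     mult = (\<lambda>a b. \<lambda>x\<in>carrier G.
       \<Oplus>\<^bsub>F\<^esub>y\<in>carrier G. a y \<otimes>\<^bsub>F\<^esub> b (inv\<^bsub>G\<^esub> y \<otimes>\<^bsub>G\<^esub> x)),
     one = (\<lambda>x\<in>carrier G. if x = \<one>\<^bsub>G\<^esub> then \<one>\<^bsub>F\<^esub> else \<zero>\<^bsub>F\<^esub>),
     zero = (\<lambda>x\<in>carrier G. \<zero>\<^bsub>F\<^esub>),
     add = (\<lambda>a b. \<lambda>x\<in>carrier G. a x \<oplus>\<^bsub>F\<^esub> b x),
     smult = (\<lambda>c a. \<lambda>x\<in>carrier G. c \<otimes>\<^bsub>F\<^esub> a x)\<rparr>"

definition group_elem ::
    "('f, 'm) ring_scheme \<Rightarrow> ('g, 'n) monoid_scheme \<Rightarrow> 'g \<Rightarrow> ('g \<Rightarrow> 'f)" where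
  "group_elem F G g = (\<lambda>x\<in>carrier G. if x = g then \<one>\<^bsub>F\<^esub> else \<zero>\<^bsub>F\<^esub>)"

definition set_sum ::
    "('f, 'm) ring_scheme \<Rightarrow> ('g, 'n) monoid_scheme \<Rightarrow> 'g set \<Rightarrow> ('g \<Rightarrow> 'f)" where
  "set_sum F G A = (\<Oplus>\<^bsub>group_algebra F G\<^esub>g\<in>A. group_elem F G g)"

definition hat ::
    "('f, 'm) ring_scheme \<Rightarrow> ('g, 'n) monoid_scheme \<Rightarrow> 'g set \<Rightarrow> ('g \<Rightarrow> 'f)" where
  "hat F G H = inv\<^bsub>F\<^esub> ([card H] \<cdot>\<^bsub>F\<^esub> \<one>\<^bsub>F\<^esub>) \<odot>\<^bsub>group_algebra F G\<^esub> set_sum F G H"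

text \<open>The order of 1 in the additive group, which the library sets to 0 if it is infinite.\<close>

definition ring_char :: "('f, 'm) ring_scheme \<Rightarrow> nat" where
  "ring_char R = group.ord (add_monoid R) \<one>\<^bsub>R\<^esub>"

definition normal_semilattice :: "('g, 'n) monoid_scheme \<Rightarrow> 'g set set \<Rightarrow> bool" where
  "normal_semilattice G \<L> \<longleftrightarrow>
    (\<forall>H\<in>\<L>. H \<lhd> G) \<and>
    (\<forall>H\<in>\<L>. \<forall>K\<in>\<L>. H <#>\<^bsub>G\<^esub> K \<in> \<L>) \<and>
    {\<one>\<^bsub>G\<^esub>} \<in> \<L> \<and> carrier G \<in> \<L>"

definition covers :: "'g set set \<Rightarrow> 'g set \<Rightarrow> 'g set set" where
  "covers \<L> H = {K \<in> \<L>. H \<subset> K \<and> (\<forall>L\<in>\<L>. H \<subseteq> L \<and> L \<subseteq> K \<longrightarrow> L = H \<or> L = K)}"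

definition semilattice_algebra ::
    "('f, 'm) ring_scheme \<Rightarrow> ('g, 'n) monoid_scheme \<Rightarrow> 'g set set \<Rightarrow> ('f, 'g \<Rightarrow> 'f) module" where
  "semilattice_algebra F G \<L> = (group_algebra F G)
    \<lparr>carrier := LinearCombinations.module.span F (group_algebra F G) (set_sum F G ` \<L>)\<rparr>"

text \<open>
  The product is taken in the group algebra, which need not be commutative.  It does not
  depend on an order of the factors because they are central, the subgroups being normal.
\<close>

definition eps ::
    "('f, 'm) ring_scheme \<Rightarrow> ('g, 'n) monoid_scheme \<Rightarrow> 'g set set \<Rightarrow> 'g set \<Rightarrow> ('g \<Rightarrow> 'f)" where
  "eps F G \<L> H =
    (if H = carrier G then hat F G (carrier G)
     else \<Otimes>\<^bsub>group_algebra F G\<^esub>M\<in>covers \<L> H. hat F G H \<ominus>\<^bsub>group_algebra F G\<^esub> hat F G M)"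

definition central_idempotents :: "('a, 'm) ring_scheme \<Rightarrow> 'a set" where
  "central_idempotents R =
    {e \<in> carrier R. e \<otimes>\<^bsub>R\<^esub> e = e \<and> (\<forall>x\<in>carrier R. e \<otimes>\<^bsub>R\<^esub> x = x \<otimes>\<^bsub>R\<^esub> e)}"

text \<open>
  The two summands are required to be orthogonal.  This is automatic if 2 is not a zero
  divisor; in characteristic 2, however, \<open>e = 1 + (1 - e)\<close> decomposes every idempotent
  \<open>e \<noteq> 1\<close> into a sum of two nonzero, non-orthogonal idempotents.
\<close>

definition primitive_central_idempotents :: "('a, 'm) ring_scheme \<Rightarrow> 'a set" where
  "primitive_central_idempotents R =
    {e \<in> central_idempotents R. e \<noteq> \<zero>\<^bsub>R\<^esub> \<and>
      \<not> (\<exists>f\<in>central_idempotents R. \<exists>g\<in>central_idempotents R.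
            f \<noteq> \<zero>\<^bsub>R\<^esub> \<and> g \<noteq> \<zero>\<^bsub>R\<^esub> \<and> f \<otimes>\<^bsub>R\<^esub> g = \<zero>\<^bsub>R\<^esub> \<and> e = f \<oplus>\<^bsub>R\<^esub> g)}"

definition direct_power :: "('f, 'm) ring_scheme \<Rightarrow> nat \<Rightarrow> ('f, nat \<Rightarrow> 'f) module" where
  "direct_power F n =
    \<lparr>carrier = {..<n} \<rightarrow>\<^sub>E carrier F,
     mult = (\<lambda>a b. \<lambda>i\<in>{..<n}. a i \<otimes>\<^bsub>F\<^esub> b i),
     one = (\<lambda>i\<in>{..<n}. \<one>\<^bsub>F\<^esub>),
     zero = (\<lambda>i\<in>{..<n}. \<zero>\<^bsub>F\<^esub>),
     add = (\<lambda>a b. \<lambda>i\<in>{..<n}. a i \<oplus>\<^bsub>F\<^esub> b i),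
     smult = (\<lambda>c a. \<lambda>i\<in>{..<n}. c \<otimes>\<^bsub>F\<^esub> a i)\<rparr>"

definition algebra_isomorphic ::
    "('f, 'm) ring_scheme \<Rightarrow> ('f, 'a, 'p) module_scheme \<Rightarrow> ('f, 'b, 'q) module_scheme \<Rightarrow> bool" where
  "algebra_isomorphic F A B \<longleftrightarrow>
    (\<exists>h\<in>ring_iso A B. \<forall>c\<in>carrier F. \<forall>x\<in>carrier A. h (c \<odot>\<^bsub>A\<^esub> x) = c \<odot>\<^bsub>B\<^esub> h x)"

end

theory Submission
  imports Defs "HOL-Algebra.Subrings"
begin

text \<open>
  Normal subgroups satisfy \<open>hat H * hat K = hat (H <#> K)\<close>, so \<open>hat\<close> turns the join
  semilattice \<open>\<L>\<close> into commuting idempotents.  Hence \<open>hat K * eps H\<close> is \<open>eps H\<close>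
  if \<open>K \<subseteq> H\<close>, and 0 otherwise: there is then a cover \<open>M\<close> of \<open>H\<close> with
  \<open>M \<subseteq> H <#> K\<close>, and \<open>hat K\<close> annihilates the factor \<open>hat H - hat M\<close>.  It follows that the
  \<open>eps H\<close> are orthogonal idempotents on which \<open>S(\<L>)\<close> acts by scalars.  Anything that
  annihilates all \<open>eps H\<close> annihilates all \<open>hat H\<close>, by induction downwards from \<open>G\<close>, and
  in particular 1; so their sum is 1.  A commutative algebra with such idempotents is a power
  of the base field, and they are its primitive idempotents.
\<close>

section \<open>Algebras split by orthogonal idempotents\<close>

text \<open>\<open>E_scalar\<close> and \<open>E_nonzero\<close> make each ideal generated by an
  \<open>e\<close> in \<open>E\<close> a line over the field, and \<open>E_sum\<close> with
  \<open>E_orth\<close> make \<open>A\<close> the direct sum of these lines. Everything below is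
  read off from this picture.\<close>

locale split_idempotents = algebra F A
  for F :: "('f, 'm) ring_scheme" (structure) and A :: "('f, 'a, 'p) module_scheme" (structure) +
  fixes E
  assumes field_F: "field F"
    and finite_E: "finite E"
    and E_carrier: "E \<subseteq> carrier A"
    and E_nonzero: "e \<in> E \<Longrightarrow> e \<noteq> \<zero>\<^bsub>A\<^esub>"
    and E_idem: "e \<in> E \<Longrightarrow> e \<otimes>\<^bsub>A\<^esub> e = e"
    and E_orth: "\<lbrakk>e \<in> E; f \<in> E; e \<noteq> f\<rbrakk> \<Longrightarrow> e \<otimes>\<^bsub>A\<^esub> f = \<zero>\<^bsub>A\<^esub>"
    and E_sum: "(\<Oplus>\<^bsub>A\<^esub>e\<in>E. e) = \<one>\<^bsub>A\<^esub>"
    and E_scalar: "\<lbrakk>x \<in> carrier A; e \<in> E\<rbrakk> \<Longrightarrow> \<exists>c\<in>carrier F. x \<otimes>\<^bsub>A\<^esub> e = c \<odot>\<^bsub>A\<^esub> e"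
begin

section \<open>Coordinates along the idempotents\<close>

lemma E_closed: "e \<in> E \<Longrightarrow> e \<in> carrier A"
  using E_carrier by blast

lemma smult_E_eq_zero:
  assumes "c \<in> carrier F" "e \<in> E" "c \<odot>\<^bsub>A\<^esub> e = \<zero>\<^bsub>A\<^esub>"
  shows "c = \<zero>"
proof (rule ccontr)
  assume "c \<noteq> \<zero>"
  then have c: "c \<in> Units F" using assms(1) field.field_Units[OF field_F] by simp
  have "e = (inv c \<otimes> c) \<odot>\<^bsub>A\<^esub> e" using c E_closed assms(2) by simp
  also have "\<dots> = inv c \<odot>\<^bsub>A\<^esub> (c \<odot>\<^bsub>A\<^esub> e)" using R.Units_inv_closed[OF c] E_closed assms(1,2) by (simp add: smult_assoc1 del: R.Units_l_inv)
  also have "\<dots> = \<zero>\<^bsub>A\<^esub>" using R.Units_inv_closed[OF c] assms by simp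
  finally show False using E_nonzero assms by blast
qed

lemma smult_E_inject:
  assumes "c \<in> carrier F" "d \<in> carrier F" "e \<in> E" "c \<odot>\<^bsub>A\<^esub> e = d \<odot>\<^bsub>A\<^esub> e"
  shows "c = d"
proof -
  have "(c \<ominus> d) \<odot>\<^bsub>A\<^esub> e = \<zero>\<^bsub>A\<^esub>"
    using assms E_closed by (simp add: a_minus_def smult_l_distr smult_l_minus M.r_neg)
  then have "c \<ominus> d = \<zero>" using assms by (intro smult_E_eq_zero[of _ e]) auto
  then show ?thesis using assms by (simp add: R.r_right_minus_eq)
qed

text \<open>The eigenvalue of multiplication by \<open>x\<close> on the line through
  \<open>e\<close>. For \<open>e\<close> in \<open>E\<close> the description is met: existence is
  \<open>E_scalar\<close>, uniqueness \<open>smult_E_inject\<close>.\<close>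

definition coord :: "'a \<Rightarrow> 'a \<Rightarrow> 'f" where
  "coord x e = (THE c. c \<in> carrier F \<and> x \<otimes>\<^bsub>A\<^esub> e = c \<odot>\<^bsub>A\<^esub> e)"

lemma coord_eqI:
  assumes "e \<in> E" "c \<in> carrier F" "x \<otimes>\<^bsub>A\<^esub> e = c \<odot>\<^bsub>A\<^esub> e"
  shows "coord x e = c"
  unfolding coord_def using assms smult_E_inject[of _ c e] by (intro the_equality) auto

lemma
  assumes "x \<in> carrier A" "e \<in> E"
  shows coord_closed: "coord x e \<in> carrier F"
    and mult_E: "x \<otimes>\<^bsub>A\<^esub> e = coord x e \<odot>\<^bsub>A\<^esub> e"
  using E_scalar[OF assms] coord_eqI[OF assms(2)] by metis+

text \<open>Multiply \<open>x\<close> into the decomposition \<open>E_sum\<close> of 1. Hence an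
  element is determined by its products with the members of \<open>E\<close>.\<close>

lemma sum_components:
  assumes "x \<in> carrier A"
  shows "(\<Oplus>\<^bsub>A\<^esub>e\<in>E. x \<otimes>\<^bsub>A\<^esub> e) = x"
proof -
  have "x = x \<otimes>\<^bsub>A\<^esub> (\<Oplus>\<^bsub>A\<^esub>e\<in>E. e)" using assms E_sum by simp
  also have "\<dots> = (\<Oplus>\<^bsub>A\<^esub>e\<in>E. x \<otimes>\<^bsub>A\<^esub> e)"
    using assms finite_E E_carrier by (intro finsum_rdistr) auto
  finally show ?thesis by simp
qed

lemma components_eqI:
  assumes "x \<in> carrier A" "y \<in> carrier A" "\<And>e. e \<in> E \<Longrightarrow> x \<otimes>\<^bsub>A\<^esub> e = y \<otimes>\<^bsub>A\<^esub> e"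
  shows "x = y"
proof -
  have "x = (\<Oplus>\<^bsub>A\<^esub>e\<in>E. x \<otimes>\<^bsub>A\<^esub> e)" using assms(1) sum_components by simp
  also have "\<dots> = (\<Oplus>\<^bsub>A\<^esub>e\<in>E. y \<otimes>\<^bsub>A\<^esub> e)" using assms E_closed by (intro M.finsum_cong') auto
  finally show ?thesis using assms(2) sum_components by simp
qed

text \<open>Orthogonality kills every summand but the one at \<open>e\<close>. This supplies
  preimages under the coordinate map.\<close>

lemma finsum_mult_E:
  assumes "a \<in> E \<rightarrow> carrier F" "e \<in> E"
  shows "(\<Oplus>\<^bsub>A\<^esub>f\<in>E. a f \<odot>\<^bsub>A\<^esub> f) \<otimes>\<^bsub>A\<^esub> e = a e \<odot>\<^bsub>A\<^esub> e"
proof -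
  have "(\<Oplus>\<^bsub>A\<^esub>f\<in>E. a f \<odot>\<^bsub>A\<^esub> f) \<otimes>\<^bsub>A\<^esub> e = (\<Oplus>\<^bsub>A\<^esub>f\<in>E. (a f \<odot>\<^bsub>A\<^esub> f) \<otimes>\<^bsub>A\<^esub> e)"
    using assms finite_E E_closed by (intro finsum_ldistr) auto
  also have "\<dots> = (\<Oplus>\<^bsub>A\<^esub>f\<in>E. if e = f then a f \<odot>\<^bsub>A\<^esub> f else \<zero>\<^bsub>A\<^esub>)"
  proof (rule M.finsum_cong')
    fix f assume "f \<in> E"
    then show "(a f \<odot>\<^bsub>A\<^esub> f) \<otimes>\<^bsub>A\<^esub> e = (if e = f then a f \<odot>\<^bsub>A\<^esub> f else \<zero>\<^bsub>A\<^esub>)"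
      using assms E_closed E_idem E_orth[of f e] by (auto simp: smult_assoc2 Pi_iff)
  qed (use assms E_closed in \<open>auto simp: Pi_iff\<close>)
  also have "\<dots> = a e \<odot>\<^bsub>A\<^esub> e"
    using assms finite_E E_closed by (intro M.finsum_singleton) (auto simp: Pi_iff intro!: smult_closed)
  finally show ?thesis .
qed

text \<open>The scalar \<open>c\<close> by which \<open>f\<close> acts on the line through
  \<open>e\<close> satisfies \<open>c \<otimes> c = c\<close>, and a field has no such elements
  besides 0 and 1.\<close>

lemma idempotent_mult_E:
  assumes "f \<in> carrier A" "f \<otimes>\<^bsub>A\<^esub> f = f" "e \<in> E"
  shows "f \<otimes>\<^bsub>A\<^esub> e = e \<or> f \<otimes>\<^bsub>A\<^esub> e = \<zero>\<^bsub>A\<^esub>"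
proof -
  interpret F: field F by (rule field_F)
  define c where "c = coord f e"
  have c: "c \<in> carrier F" "f \<otimes>\<^bsub>A\<^esub> e = c \<odot>\<^bsub>A\<^esub> e"
    using coord_closed mult_E assms by (auto simp: c_def)
  have e: "e \<in> carrier A" using assms E_closed by blast
  have "f \<otimes>\<^bsub>A\<^esub> e = f \<otimes>\<^bsub>A\<^esub> (f \<otimes>\<^bsub>A\<^esub> e)"
    using assms e m_assoc[of f f e] by simp
  also have "\<dots> = c \<odot>\<^bsub>A\<^esub> (f \<otimes>\<^bsub>A\<^esub> e)"
    using assms e c smult_assoc2[of c e f] by (simp add: m_comm)
  finally have "(c \<otimes> c) \<odot>\<^bsub>A\<^esub> e = c \<odot>\<^bsub>A\<^esub> e" using c e by (simp add: smult_assoc1)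
  then have cc: "c \<otimes> c = c" using smult_E_inject[of "c \<otimes> c" c e] c assms by simp
  have "c = \<one> \<or> c = \<zero>"
  proof (cases "c = \<zero>")
    case False
    have "c \<otimes> c = c \<otimes> \<one>" using cc c by simp
    then show ?thesis using F.m_lcancel[OF False c(1) c(1) R.one_closed] by simp
  qed simp
  then show ?thesis using c e by auto
qed

text \<open>If \<open>e\<close> in \<open>E\<close> splits orthogonally as \<open>f + g\<close> with
  \<open>f\<close> nonzero, then \<open>f = f e\<close> must be \<open>e\<close> itself, so
  \<open>g\<close> vanishes. Conversely, a nonzero idempotent \<open>e\<close> has a nonzero product
  with some \<open>f\<close> in \<open>E\<close>; that product is \<open>f\<close>, so
  \<open>e = f + (e - f)\<close> is an orthogonal splitting, and primitivity forces
  \<open>e = f\<close>.\<close>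

lemma primitive_central_idempotents_eq: "primitive_central_idempotents A = E"
proof (intro equalityI subsetI)
  fix e assume e: "e \<in> E"
  have False if "f \<in> central_idempotents A" "g \<in> central_idempotents A"
    "f \<noteq> \<zero>\<^bsub>A\<^esub>" "g \<noteq> \<zero>\<^bsub>A\<^esub>" "f \<otimes>\<^bsub>A\<^esub> g = \<zero>\<^bsub>A\<^esub>" "e = f \<oplus>\<^bsub>A\<^esub> g" for f g
  proof -
    have fg: "f \<in> carrier A" "g \<in> carrier A" "f \<otimes>\<^bsub>A\<^esub> f = f"
      using that(1,2) by (auto simp: central_idempotents_def)
    have "f \<otimes>\<^bsub>A\<^esub> e = f" using that(5,6) fg by (simp add: r_distr)
    then have "f = f \<oplus>\<^bsub>A\<^esub> g" using idempotent_mult_E[OF fg(1,3) e] that(3,6) by auto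
    then show False using fg that(4) by simp
  qed
  moreover have "e \<in> central_idempotents A"
    using e E_closed E_idem by (auto simp: central_idempotents_def m_comm)
  ultimately show "e \<in> primitive_central_idempotents A"
    using E_nonzero[OF e] unfolding primitive_central_idempotents_def by blast
next
  fix e assume e: "e \<in> primitive_central_idempotents A"
  have e_props: "e \<in> carrier A" "e \<otimes>\<^bsub>A\<^esub> e = e" "e \<noteq> \<zero>\<^bsub>A\<^esub>"
    using e unfolding primitive_central_idempotents_def central_idempotents_def by blast+
  obtain f where f: "f \<in> E" "e \<otimes>\<^bsub>A\<^esub> f \<noteq> \<zero>\<^bsub>A\<^esub>"
    using components_eqI[of e "\<zero>\<^bsub>A\<^esub>"] e_props E_closed by auto
  then have ef: "e \<otimes>\<^bsub>A\<^esub> f = f" "f \<in> carrier A" "f \<otimes>\<^bsub>A\<^esub> f = f"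
    using idempotent_mult_E[of e f] e_props E_closed E_idem by auto
  have fe: "f \<otimes>\<^bsub>A\<^esub> e = f" using ef e_props by (simp add: m_comm)
  define g where "g = e \<ominus>\<^bsub>A\<^esub> f"
  have g: "g \<in> carrier A" using e_props ef by (simp add: g_def)
  have "g \<otimes>\<^bsub>A\<^esub> e = g" "g \<otimes>\<^bsub>A\<^esub> f = \<zero>\<^bsub>A\<^esub>"
    using e_props ef fe by (simp_all add: g_def a_minus_def l_distr l_minus M.r_neg)
  then have gg: "g \<otimes>\<^bsub>A\<^esub> g = g" and fg: "f \<otimes>\<^bsub>A\<^esub> g = \<zero>\<^bsub>A\<^esub>"
    using e_props ef g by (simp_all add: m_comm[of f g]) (simp add: g_def a_minus_def r_distr r_minus)
  have efg: "e = f \<oplus>\<^bsub>A\<^esub> g"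
    using e_props ef by (simp add: g_def a_minus_def M.a_comm[of f] M.a_assoc M.l_neg)
  have "f \<in> central_idempotents A" "g \<in> central_idempotents A"
    using ef g gg by (auto simp: central_idempotents_def m_comm)
  then have "g = \<zero>\<^bsub>A\<^esub>"
    using e efg fg f E_nonzero unfolding primitive_central_idempotents_def by blast
  then have "e = f" using efg ef by simp
  then show "e \<in> E" using f by simp
qed

text \<open>Together: for each \<open>e\<close> in \<open>E\<close>, \<open>coord _ e\<close> is a
  homomorphism of algebras from \<open>A\<close> onto the base field.\<close>

lemma
  assumes "e \<in> E" "x \<in> carrier A" "y \<in> carrier A"
  shows coord_add: "coord (x \<oplus>\<^bsub>A\<^esub> y) e = coord x e \<oplus> coord y e"
    and coord_mult: "coord (x \<otimes>\<^bsub>A\<^esub> y) e = coord x e \<otimes> coord y e"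
    and coord_smult: "c \<in> carrier F \<Longrightarrow> coord (c \<odot>\<^bsub>A\<^esub> x) e = c \<otimes> coord x e"
    and coord_one: "coord \<one>\<^bsub>A\<^esub> e = \<one>"
proof -
  note E = E_closed[OF assms(1)] and X = coord_closed[OF assms(2,1)] coord_closed[OF assms(3,1)]
    mult_E[OF assms(2,1)] mult_E[OF assms(3,1)]
  show "coord (x \<oplus>\<^bsub>A\<^esub> y) e = coord x e \<oplus> coord y e"
    using E X assms by (intro coord_eqI) (simp_all add: l_distr smult_l_distr)
  have "(x \<otimes>\<^bsub>A\<^esub> y) \<otimes>\<^bsub>A\<^esub> e = x \<otimes>\<^bsub>A\<^esub> (coord y e \<odot>\<^bsub>A\<^esub> e)"
    using E X assms by (simp add: m_assoc)
  also have "\<dots> = coord y e \<odot>\<^bsub>A\<^esub> (x \<otimes>\<^bsub>A\<^esub> e)"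
    using E X(1,2) assms smult_assoc2[of "coord y e" e x] by (simp add: m_comm)
  also have "\<dots> = (coord x e \<otimes> coord y e) \<odot>\<^bsub>A\<^esub> e"
    using E X assms smult_assoc1[of "coord y e" "coord x e" e] by (simp add: R.m_comm)
  finally show "coord (x \<otimes>\<^bsub>A\<^esub> y) e = coord x e \<otimes> coord y e"
    using X assms by (intro coord_eqI) simp_all
  show "coord (c \<odot>\<^bsub>A\<^esub> x) e = c \<otimes> coord x e" if "c \<in> carrier F"
    using that E X assms by (intro coord_eqI) (simp_all add: smult_assoc1 smult_assoc2)
  show "coord \<one>\<^bsub>A\<^esub> e = \<one>"
    using E assms by (intro coord_eqI) simp_all
qed

text \<open>The isomorphism sends \<open>x\<close> to the tuple of its coordinates. It is injective
  by \<open>components_eqI\<close>, and a tuple is attained at the combination of \<open>E\<close>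
  having it as coefficients.\<close>

lemma algebra_isomorphic_direct_power: "algebra_isomorphic F A (direct_power F (card E))"
proof -
  obtain b where b: "bij_betw b {..<card E} E"
    using ex_bij_betw_nat_finite[OF finite_E] by (auto simp: atLeast0LessThan)
  have bE: "b i \<in> E" if "i < card E" for i using b that by (auto dest: bij_betwE)
  define h where "h = (\<lambda>x. \<lambda>i\<in>{..<card E}. coord x (b i))"
  have bij: "bij_betw h (carrier A) ({..<card E} \<rightarrow>\<^sub>E carrier F)"
  proof (rule bij_betwI')
    fix x y assume xy: "x \<in> carrier A" "y \<in> carrier A"
    have "x = y" if "h x = h y"
    proof (rule components_eqI[OF xy])
      fix e assume e: "e \<in> E"
      then obtain i where "i < card E" "e = b i" using b by (auto simp: bij_betw_def)
      then have "coord x e = coord y e" using fun_cong[OF that, of i] by (simp add: h_def)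
      then show "x \<otimes>\<^bsub>A\<^esub> e = y \<otimes>\<^bsub>A\<^esub> e" using xy e by (simp add: mult_E)
    qed
    then show "(h x = h y) = (x = y)" by blast
  next
    fix x assume "x \<in> carrier A"
    then show "h x \<in> {..<card E} \<rightarrow>\<^sub>E carrier F" using bE coord_closed by (auto simp: h_def)
  next
    fix a assume a: "a \<in> {..<card E} \<rightarrow>\<^sub>E carrier F"
    \<comment> \<open>The tuple \<open>a\<close>, re-indexed by \<open>E\<close> through the inverse
      of the enumeration \<open>b\<close>.\<close>
    define a' where "a' = (\<lambda>e. a (the_inv_into {..<card E} b e))"
    have a': "a' \<in> E \<rightarrow> carrier F"
      using a bij_betw_the_inv_into[OF b] by (force simp: a'_def dest: bij_betwE)
    have a'b: "a' (b i) = a i" if "i < card E" for i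
      using that b by (simp add: a'_def the_inv_into_f_f bij_betw_def)
    let ?x = "\<Oplus>\<^bsub>A\<^esub>e\<in>E. a' e \<odot>\<^bsub>A\<^esub> e"
    have "?x \<in> carrier A" using a' E_closed by (intro M.finsum_closed) auto
    moreover have "a = h ?x"
    proof (rule extensionalityI[of _ "{..<card E}"])
      fix i assume "i \<in> {..<card E}"
      then have i: "i < card E" by simp
      have "coord ?x (b i) = a' (b i)"
        using finsum_mult_E[OF a' bE[OF i]] a' bE[OF i] by (intro coord_eqI) auto
      then show "a i = h ?x i" using i a'b by (simp add: h_def)
    qed (use a in \<open>auto simp: h_def PiE_def\<close>)
    ultimately show "\<exists>x\<in>carrier A. a = h x" by blast
  qed
  have "h \<in> ring_iso A (direct_power F (card E))"
  proof (rule ring_iso_memI)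
    show "bij_betw h (carrier A) (carrier (direct_power F (card E)))"
      using bij by (simp add: direct_power_def)
    fix x assume "x \<in> carrier A"
    then show "h x \<in> carrier (direct_power F (card E))"
      using bij by (auto simp: direct_power_def dest: bij_betwE)
  \<comment> \<open>\<open>coord_one\<close> carries the membership premises on \<open>x\<close> and
    \<open>y\<close> of the joint statement; zero is put in for both.\<close>
  qed (auto simp: h_def direct_power_def fun_eq_iff bE coord_mult coord_add
        coord_one[OF _ M.zero_closed M.zero_closed])
  moreover have "h (c \<odot>\<^bsub>A\<^esub> x) = c \<odot>\<^bsub>direct_power F (card E)\<^esub> h x"
    if "c \<in> carrier F" "x \<in> carrier A" for c x
    using that by (auto simp: h_def direct_power_def fun_eq_iff bE coord_smult[OF _ _ M.zero_closed])
  ultimately show ?thesis unfolding algebra_isomorphic_def by blast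
qed

end

section \<open>Semilattices of idempotents\<close>

text \<open>All that is kept of the subgroups is their order by inclusion and their joins.
  \<open>u\<close> turns joins into products, so each \<open>u H\<close> is idempotent because the
  join of \<open>H\<close> with itself is \<open>H\<close>.\<close>

locale idempotent_semilattice = cring A for A :: "('a, 'm) ring_scheme" (structure) +
  fixes \<L> :: "'b set set" and join :: "'b set \<Rightarrow> 'b set \<Rightarrow> 'b set"
    and bot top :: "'b set" and u :: "'b set \<Rightarrow> 'a"
  assumes finite_L: "finite \<L>"
    and bot_L: "bot \<in> \<L>"
    and top_L: "top \<in> \<L>"
    and subset_top: "H \<in> \<L> \<Longrightarrow> H \<subseteq> top"
    and join_L: "\<lbrakk>H \<in> \<L>; K \<in> \<L>\<rbrakk> \<Longrightarrow> join H K \<in> \<L>"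
    and join_upper1: "\<lbrakk>H \<in> \<L>; K \<in> \<L>\<rbrakk> \<Longrightarrow> H \<subseteq> join H K"
    and join_upper2: "\<lbrakk>H \<in> \<L>; K \<in> \<L>\<rbrakk> \<Longrightarrow> K \<subseteq> join H K"
    and join_least: "\<lbrakk>H \<in> \<L>; K \<in> \<L>; M \<in> \<L>; H \<subseteq> M; K \<subseteq> M\<rbrakk> \<Longrightarrow> join H K \<subseteq> M"
    and u_closed [simp]: "H \<in> \<L> \<Longrightarrow> u H \<in> carrier A"
    and u_join: "\<lbrakk>H \<in> \<L>; K \<in> \<L>\<rbrakk> \<Longrightarrow> u H \<otimes> u K = u (join H K)"
    and u_bot: "u bot = \<one>"
begin

section \<open>Covers in a finite semilattice\<close>

lemma covers_L: "M \<in> covers \<L> H \<Longrightarrow> M \<in> \<L>"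
  by (simp add: covers_def)

lemma covers_psubset: "M \<in> covers \<L> H \<Longrightarrow> H \<subset> M"
  by (simp add: covers_def)

lemma finite_covers: "finite (covers \<L> H)"
  using finite_L by (rule rev_finite_subset) (auto simp: covers_def)

text \<open>Among the finitely many members of \<open>\<L>\<close> that contain \<open>H\<close>
  strictly and lie within \<open>K\<close>, a minimal one is a cover of \<open>H\<close>.\<close>

lemma ex_cover_below:
  assumes "K \<in> \<L>" "H \<subset> K"
  obtains M where "M \<in> covers \<L> H" "M \<subseteq> K"
proof -
  define S where "S = {M \<in> \<L>. H \<subset> M \<and> M \<subseteq> K}"
  have "finite S" "S \<noteq> {}" using finite_L assms by (auto simp: S_def)
  from finite_has_minimal[OF this]
  obtain M where M: "M \<in> S" and min: "\<forall>N\<in>S. N \<subseteq> M \<longrightarrow> M = N" by (elim bexE)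
  have "L = H \<or> L = M" if L: "L \<in> \<L>" "H \<subseteq> L" "L \<subseteq> M" for L
  proof (cases "L = H")
    case False
    then have "L \<in> S" using L M by (auto simp: S_def)
    then show ?thesis using min L(3) by blast
  qed simp
  then have "M \<in> covers \<L> H" using M by (simp add: S_def covers_def)
  then show ?thesis using that M by (simp add: S_def)
qed

text \<open>The join of \<open>H\<close> and \<open>K\<close> is \<open>K\<close>. Thus
  \<open>u\<close> reverses the order: larger sets give smaller idempotents.\<close>

lemma u_absorb:
  assumes "H \<in> \<L>" "K \<in> \<L>" "H \<subseteq> K"
  shows "u H \<otimes> u K = u K"
proof -
  have "join H K = K" using assms join_least[of H K K] join_upper2[of H K] by blast
  then show ?thesis using u_join assms by simp
qed

text \<open>The abstract form of \<open>eps\<close>. The top needs its own case: it has no covers,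
  so the empty product would give 1 in place of \<open>u top\<close>.\<close>

definition e :: "'b set \<Rightarrow> 'a" where
  "e H = (if H = top then u top else \<Otimes>M\<in>covers \<L> H. u H \<ominus> u M)"

lemma e_closed [simp]: "H \<in> \<L> \<Longrightarrow> e H \<in> carrier A"
  using top_L covers_L by (auto simp: e_def intro!: finprod_closed)

text \<open>Since \<open>A\<close> is commutative, any one factor can be brought to the front;
  whatever fixes or kills that factor then fixes or kills \<open>e H\<close>.\<close>

lemma e_factor:
  assumes "H \<in> \<L>" "M \<in> covers \<L> H"
  obtains r where "r \<in> carrier A" "e H = (u H \<ominus> u M) \<otimes> r"
proof -
  let ?r = "\<Otimes>N\<in>covers \<L> H - {M}. u H \<ominus> u N"
  have "H \<noteq> top" using assms covers_L covers_psubset subset_top by blast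
  then have "e H = (\<Otimes>N\<in>insert M (covers \<L> H - {M}). u H \<ominus> u N)"
    by (simp add: e_def insert_absorb[OF assms(2)])
  also have "\<dots> = (u H \<ominus> u M) \<otimes> ?r"
    using assms covers_L finite_covers by (intro finprod_insert) auto
  finally have "e H = (u H \<ominus> u M) \<otimes> ?r" .
  moreover have "?r \<in> carrier A" using assms covers_L by (intro finprod_closed) auto
  ultimately show ?thesis using that by blast
qed

lemma u_mult_diff:
  assumes "K \<in> \<L>" "H \<in> \<L>" "M \<in> \<L>"
  shows "u K \<otimes> (u H \<ominus> u M) = u (join K H) \<ominus> u (join K M)"
  using assms by (simp add: a_minus_def r_distr r_minus u_join)

text \<open>Below the top there is a cover \<open>M\<close>, and
  \<open>K \<subseteq> H \<subseteq> M\<close> lets \<open>u K\<close> be absorbed by both terms of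
  the single factor \<open>u H \<ominus> u M\<close>.\<close>

lemma u_mult_e:
  assumes "K \<in> \<L>" "H \<in> \<L>" "K \<subseteq> H"
  shows "u K \<otimes> e H = e H"
proof (cases "H = top")
  case True
  then show ?thesis using assms u_absorb by (simp add: e_def)
next
  case False
  then have "H \<subset> top" using subset_top assms by blast
  then obtain M where M: "M \<in> covers \<L> H"
    using ex_cover_below[OF top_L] by metis
  obtain r where r: "r \<in> carrier A" "e H = (u H \<ominus> u M) \<otimes> r"
    using e_factor[OF assms(2) M] .
  have L: "M \<in> \<L>" "K \<subseteq> M" using M assms covers_L covers_psubset by blast+
  have "u K \<otimes> (u H \<ominus> u M) = u H \<ominus> u M"
    using u_mult_diff[OF assms(1,2) L(1)] u_absorb[OF assms] u_absorb[OF assms(1) L] assms L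
    by (simp add: u_join)
  then show ?thesis using r assms L m_assoc[of "u K" "u H \<ominus> u M" r] by simp
qed

text \<open>\<open>join K H\<close> is strictly above \<open>H\<close>, so some cover
  \<open>M\<close> of \<open>H\<close> lies within it. Then \<open>K\<close> has the same join with
  \<open>M\<close> as with \<open>H\<close>, and the two terms of
  \<open>u K \<otimes> (u H \<ominus> u M)\<close> cancel.\<close>

lemma u_mult_e_eq_zero:
  assumes "K \<in> \<L>" "H \<in> \<L>" "\<not> K \<subseteq> H"
  shows "u K \<otimes> e H = \<zero>"
proof -
  have "join K H \<in> \<L>" "H \<subset> join K H"
    using assms join_L join_upper1[of K H] join_upper2[of K H] by blast+
  then obtain M where M: "M \<in> covers \<L> H" "M \<subseteq> join K H"
    by (rule ex_cover_below)
  obtain r where r: "r \<in> carrier A" "e H = (u H \<ominus> u M) \<otimes> r"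
    using e_factor[OF assms(2) M(1)] .
  have L: "M \<in> \<L>" "H \<subseteq> M" using M covers_L covers_psubset by blast+
  have "join K M \<subseteq> join K H"
    using assms L M(2) join_L join_upper1[of K H] by (intro join_least) auto
  moreover have "join K H \<subseteq> join K M"
    using assms L join_L join_upper1[of K M] join_upper2[of K M] by (intro join_least) auto
  ultimately have "join K M = join K H" by blast
  then have "u K \<otimes> (u H \<ominus> u M) = \<zero>"
    using assms L join_L by (simp add: u_mult_diff)
  then show ?thesis using r assms L m_assoc[of "u K" "u H \<ominus> u M" r] by simp
qed

text \<open>When the product defining \<open>e H\<close> is expanded, all terms except \<open>u H\<close> contain some \<open>u M\<close>.\<close>

lemma mult_e_eq_mult_u:
  assumes H: "H \<in> \<L>" and x: "x \<in> carrier A"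
    and zero: "\<And>M. M \<in> covers \<L> H \<Longrightarrow> x \<otimes> u M = \<zero>"
  shows "x \<otimes> e H = x \<otimes> u H"
proof (cases "H = top")
  case False
  \<comment> \<open>The factors are absorbed one at a time: \<open>u H\<close> acts as identity on
    \<open>u H \<ominus> u M\<close>, and \<open>x\<close> kills \<open>u M\<close>, so
    \<open>x \<otimes> u H\<close> is left unchanged.\<close>
  have "(x \<otimes> u H) \<otimes> (\<Otimes>M\<in>B. u H \<ominus> u M) = x \<otimes> u H" if "B \<subseteq> covers \<L> H" for B
    using finite_subset[OF that finite_covers] that
  proof (induction B rule: finite_induct)
    case (insert M B)
    have M: "M \<in> covers \<L> H" "M \<in> \<L>" "H \<subseteq> M"
      using insert.prems covers_L covers_psubset by blast+
    have cl: "(\<Otimes>N\<in>B. u H \<ominus> u N) \<in> carrier A" "\<And>N. N \<in> B \<Longrightarrow> N \<in> \<L>"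
      using insert.prems H covers_L by (auto intro!: finprod_closed)
    have "u H \<otimes> (u H \<ominus> u M) = u H \<ominus> u M"
      using H M u_absorb[of H H] u_absorb[of H M] by (simp add: a_minus_def r_distr r_minus)
    then have "(x \<otimes> u H) \<otimes> (u H \<ominus> u M) = x \<otimes> (u H \<ominus> u M)"
      using H M x by (simp add: m_assoc)
    also have "\<dots> = x \<otimes> u H"
      using H M x zero[OF M(1)] by (simp add: a_minus_def r_distr r_minus)
    finally have *: "(x \<otimes> u H) \<otimes> (u H \<ominus> u M) = x \<otimes> u H" .
    have "(\<Otimes>N\<in>insert M B. u H \<ominus> u N) = (u H \<ominus> u M) \<otimes> (\<Otimes>N\<in>B. u H \<ominus> u N)"
      using insert.hyps cl H M by (intro finprod_insert) auto
    then have "(x \<otimes> u H) \<otimes> (\<Otimes>N\<in>insert M B. u H \<ominus> u N) =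
        ((x \<otimes> u H) \<otimes> (u H \<ominus> u M)) \<otimes> (\<Otimes>N\<in>B. u H \<ominus> u N)"
      using cl(1) H M x by (simp add: m_assoc)
    then show ?case using * insert by simp
  qed (use H x in simp)
  then have "(x \<otimes> u H) \<otimes> e H = x \<otimes> u H" using False by (simp add: e_def)
  \<comment> \<open>The extra \<open>u H\<close> on the left is already contained in
    \<open>e H\<close>.\<close>
  then show ?thesis using H x u_mult_e[of H H] by (simp add: m_assoc)
qed (simp add: e_def)

text \<open>No cover of \<open>H\<close> is contained in \<open>H\<close>, so \<open>e H\<close>
  annihilates \<open>u M\<close> for all covers \<open>M\<close>; hence
  \<open>mult_e_eq_mult_u\<close> applies with \<open>e H\<close> itself in the role of
  \<open>x\<close>.\<close>

lemma e_idem: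
  assumes "H \<in> \<L>"
  shows "e H \<otimes> e H = e H"
proof -
  have "e H \<otimes> u M = \<zero>" if "M \<in> covers \<L> H" for M
    using that assms covers_L covers_psubset[OF that] u_mult_e_eq_zero[of M H]
    by (auto simp: m_comm)
  then have "e H \<otimes> e H = e H \<otimes> u H" using assms by (intro mult_e_eq_mult_u) auto
  then show ?thesis using assms u_mult_e[of H H] by (simp add: m_comm)
qed

lemma e_orth:
  assumes "H \<in> \<L>" "K \<in> \<L>" "H \<noteq> K"
  shows "e H \<otimes> e K = \<zero>"
proof -
  \<comment> \<open>Insert \<open>u H\<close>, which fixes \<open>e H\<close> and kills
    \<open>e K\<close>. Of two distinct sets at least one is not contained in the other, so one of
    the two orders is covered.\<close>
  have *: "e H \<otimes> e K = \<zero>" if "H \<in> \<L>" "K \<in> \<L>" "\<not> H \<subseteq> K" for H K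
  proof -
    have "e H \<otimes> e K = e H \<otimes> (u H \<otimes> e K)"
      using that u_mult_e[of H H] by (simp add: m_comm[of "e H" "u H"] flip: m_assoc)
    then show ?thesis using that u_mult_e_eq_zero[of H K] by simp
  qed
  show ?thesis using *[of H K] *[of K H] assms by (auto simp: m_comm)
qed

definition E :: "'a set" where
  "E = {e H | H. H \<in> \<L> \<and> e H \<noteq> \<zero>}"

lemma finite_E: "finite E"
  using finite_L by (simp add: E_def)

lemma E_closed: "x \<in> E \<Longrightarrow> x \<in> carrier A"
  by (auto simp: E_def)

lemma sum_E: "(\<Oplus>x\<in>E. x) = \<one>"
proof -
  let ?s = "\<Oplus>x\<in>E. x"
  have s: "?s \<in> carrier A" using E_closed by (intro finsum_closed) auto
  \<comment> \<open>The defect \<open>d\<close> is shown to annihilate every \<open>e H\<close>,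
    then every \<open>u H\<close>, and finally \<open>u bot\<close>, which is 1.\<close>
  define d where "d = \<one> \<ominus> ?s"
  have d: "d \<in> carrier A" using s by (simp add: d_def)
  have se: "?s \<otimes> e H = e H" if H: "H \<in> \<L>" for H
  proof (cases "e H = \<zero>")
    case False
    then have HE: "e H \<in> E" using H by (auto simp: E_def)
    have "?s \<otimes> e H = (\<Oplus>x\<in>E. x \<otimes> e H)"
      using finite_E E_closed H by (intro finsum_ldistr) auto
    also have "\<dots> = (\<Oplus>x\<in>E. if e H = x then x else \<zero>)"
    proof (rule finsum_cong')
      fix x assume "x \<in> E"
      then obtain K where "K \<in> \<L>" "x = e K" by (auto simp: E_def)
      \<comment> \<open>Were \<open>e K = e H\<close> with \<open>K\<close> and \<open>H\<close>
        distinct, idempotence and orthogonality would make both sides zero, so comparing values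
        instead of sets is harmless.\<close>
      then show "x \<otimes> e H = (if e H = x then x else \<zero>)"
        using H e_idem e_orth by metis
    qed (use E_closed in auto)
    also have "\<dots> = e H"
      using HE finite_E E_closed by (intro finsum_singleton) auto
    finally show ?thesis .
  qed (use s H in simp)
  have de: "d \<otimes> e H = \<zero>" if "H \<in> \<L>" for H
    using that s se by (simp add: d_def a_minus_def l_distr l_minus r_neg)
  \<comment> \<open>Downward induction on the number of members strictly above \<open>H\<close>:
    covers have fewer, and once \<open>d\<close> kills them, \<open>d \<otimes> u H\<close> equals
    \<open>d \<otimes> e H\<close>.\<close>
  have du: "d \<otimes> u H = \<zero>" if "H \<in> \<L>" for H
    using that
  proof (induction H rule: measure_induct_rule[of "\<lambda>H. card {M \<in> \<L>. H \<subset> M}"])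
    case (less H)
    have "d \<otimes> u M = \<zero>" if M: "M \<in> covers \<L> H" for M
    proof (rule less.IH)
      have "{N \<in> \<L>. M \<subset> N} \<subset> {N \<in> \<L>. H \<subset> N}"
        using covers_L[OF M] covers_psubset[OF M] by blast
      then show "card {N \<in> \<L>. M \<subset> N} < card {N \<in> \<L>. H \<subset> N}"
        using finite_L by (intro psubset_card_mono) auto
    qed (rule covers_L[OF M])
    then show ?case using mult_e_eq_mult_u[OF less.prems d] de[OF less.prems] by simp
  qed
  have "d = \<zero>" using du[OF bot_L] d by (simp add: u_bot)
  then show ?thesis using s by (simp add: d_def)
qed

end

section \<open>Group algebras\<close>

lemma (in abelian_monoid) finsum_swap:
  assumes "finite A" "finite B" "\<And>a b. \<lbrakk>a \<in> A; b \<in> B\<rbrakk> \<Longrightarrow> f a b \<in> carrier G"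
  shows "(\<Oplus>a\<in>A. \<Oplus>b\<in>B. f a b) = (\<Oplus>b\<in>B. \<Oplus>a\<in>A. f a b)"
  using assms(1,3)
proof (induction A rule: finite_induct)
  case (insert x A)
  have "(\<Oplus>a\<in>insert x A. \<Oplus>b\<in>B. f a b) = (\<Oplus>b\<in>B. f x b) \<oplus> (\<Oplus>b\<in>B. \<Oplus>a\<in>A. f a b)"
    using insert by (subst finsum_insert) (auto intro!: finsum_closed)
  also have "\<dots> = (\<Oplus>b\<in>B. f x b \<oplus> (\<Oplus>a\<in>A. f a b))"
    using insert by (intro finsum_addf[symmetric]) (auto intro!: finsum_closed)
  also have "\<dots> = (\<Oplus>b\<in>B. \<Oplus>a\<in>insert x A. f a b)"
    using insert by (intro finsum_cong') (auto simp: finsum_insert intro!: finsum_closed)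
  finally show ?case .
qed simp

lemma (in ring) finsum_indicator:
  assumes "finite S"
  shows "(\<Oplus>y\<in>S. if P y then \<one> else \<zero>) = [card {y \<in> S. P y}] \<cdot> \<one>"
proof -
  have "(\<Oplus>y\<in>S. if P y then \<one> else \<zero>) = (\<Oplus>y\<in>{y \<in> S. P y}. \<one>)"
    using assms by (intro add.finprod_mono_neutral_cong_right) auto
  then show ?thesis by (simp add: add.finprod_const)
qed

text \<open>The negative is a definite description over the carrier, which shrinks here; uniqueness
  of additive inverses in the subring identifies the two.\<close>

lemma (in ring) a_inv_subring:
  assumes "subring H R" "x \<in> H"
  shows "\<ominus>\<^bsub>R\<lparr>carrier := H\<rparr>\<^esub> x = \<ominus> x"
proof -
  interpret H: ring "R\<lparr>carrier := H\<rparr>" using assms(1) by (rule subring_is_ring)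
  have "x \<in> carrier R" "\<ominus> x \<in> H" using assms subringE(1,5)[OF assms(1)] by auto
  then show ?thesis using assms(2) H.minus_equality[of "\<ominus> x" x] by (simp add: l_neg)
qed

text \<open>
  In a noncommutative ring \<open>finprod\<close> is a definite description that need not be satisfied;
  commutativity of the factors makes it well defined.
\<close>

lemma (in ring) finprod_subcring:
  assumes "subcring H R" "finite A" "f \<in> A \<rightarrow> H"
  shows "finprod R f A = finprod (R\<lparr>carrier := H\<rparr>) f A"
proof -
  interpret H: cring "R\<lparr>carrier := H\<rparr>" using assms(1) subcring_iff subcringE(1) by blast
  have H: "H \<subseteq> carrier R" using assms(1) by (rule subcringE)
  have comm: "x \<otimes> y = y \<otimes> x" if "x \<in> H" "y \<in> H" for x y
    using H.m_comm that by simp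
  \<comment> \<open>The fold requires only that left multiplications by the factors commute on
    \<open>R\<close>; associativity reduces this to commutation within \<open>H\<close>, while
    \<open>z\<close> stays arbitrary.\<close>
  interpret LCD "{x. f x \<in> H}" "carrier R" "mult R \<circ> f"
  proof
    fix x y z assume "x \<in> {x. f x \<in> H}" "y \<in> {x. f x \<in> H}" "z \<in> carrier R"
    then show "(mult R \<circ> f) x ((mult R \<circ> f) y z) = (mult R \<circ> f) y ((mult R \<circ> f) x z)"
      using H comm by (auto simp: subset_iff simp flip: m_assoc)
  qed (use H in auto)
  show ?thesis
    using assms(2,3)
  proof (induction A rule: finite_induct)
    case empty
    have "\<one> \<in> H" using H.one_closed by simp
    then show ?case by (simp add: finprod_def foldD_empty)
  next
    case (insert x A)
    have "finprod R f (insert x A) = f x \<otimes> finprod R f A"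
      using insert by (simp add: finprod_def) (subst foldD_insert, auto)
    then show ?case using insert by simp
  qed
qed

text \<open>The elements satisfying \<open>P\<close> form a submodule that contains
  \<open>B\<close>.\<close>

lemma (in module) span_induct [consumes 2, case_names zero add smult base]:
  assumes "x \<in> span B" "B \<subseteq> carrier M"
    and "P \<zero>\<^bsub>M\<^esub>"
    and "\<And>x y. \<lbrakk>x \<in> carrier M; y \<in> carrier M; P x; P y\<rbrakk> \<Longrightarrow> P (x \<oplus>\<^bsub>M\<^esub> y)"
    and "\<And>c x. \<lbrakk>c \<in> carrier R; x \<in> carrier M; P x\<rbrakk> \<Longrightarrow> P (c \<odot>\<^bsub>M\<^esub> x)"
    and "\<And>b. b \<in> B \<Longrightarrow> P b"
  shows "P x"
proof -
  have "submodule R {x \<in> carrier M. P x} M"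
    using assms(3-5) module_axioms by (auto simp: submodule_def)
  then have "span B \<subseteq> {x \<in> carrier M. P x}"
    using assms(2,6) by (intro span_is_subset) auto
  then show ?thesis using assms(1) by blast
qed

locale finite_group_algebra = G?: group G + F?: field F
  for G :: "('g, 'n) monoid_scheme" (structure) and F :: "('f, 'm) ring_scheme" (structure) +
  assumes finite_G: "finite (carrier G)"
begin

abbreviation FG where "FG \<equiv> group_algebra F G"

section \<open>Ring and module structure of the group algebra\<close>

lemma FG_simps [simp]:
  "carrier FG = carrier G \<rightarrow>\<^sub>E carrier F"
  "\<zero>\<^bsub>FG\<^esub> = (\<lambda>x\<in>carrier G. \<zero>\<^bsub>F\<^esub>)"
  by (simp_all add: group_algebra_def)

lemma one_apply: "x \<in> carrier G \<Longrightarrow> \<one>\<^bsub>FG\<^esub> x = (if x = \<one> then \<one>\<^bsub>F\<^esub> else \<zero>\<^bsub>F\<^esub>)"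
  by (simp add: group_algebra_def)

lemma add_apply: "x \<in> carrier G \<Longrightarrow> (a \<oplus>\<^bsub>FG\<^esub> b) x = a x \<oplus>\<^bsub>F\<^esub> b x"
  by (simp add: group_algebra_def)

lemma smult_apply: "x \<in> carrier G \<Longrightarrow> (c \<odot>\<^bsub>FG\<^esub> a) x = c \<otimes>\<^bsub>F\<^esub> a x"
  by (simp add: group_algebra_def)

lemma mult_apply:
  "x \<in> carrier G \<Longrightarrow> (a \<otimes>\<^bsub>FG\<^esub> b) x = (\<Oplus>\<^bsub>F\<^esub>y\<in>carrier G. a y \<otimes>\<^bsub>F\<^esub> b (inv y \<otimes> x))"
  by (simp add: group_algebra_def)

lemma FG_apply_closed: "\<lbrakk>a \<in> carrier FG; x \<in> carrier G\<rbrakk> \<Longrightarrow> a x \<in> carrier F"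
  by auto

lemma FG_eqI:
  assumes "a \<in> carrier FG" "b \<in> carrier FG" "\<And>x. x \<in> carrier G \<Longrightarrow> a x = b x"
  shows "a = b"
  using assms by (intro PiE_ext[of a "carrier G" "\<lambda>_. carrier F" b]) auto

lemma one_FG_closed: "\<one>\<^bsub>FG\<^esub> \<in> carrier FG"
  by (simp add: group_algebra_def)

lemma add_FG_closed: "\<lbrakk>a \<in> carrier FG; b \<in> carrier FG\<rbrakk> \<Longrightarrow> a \<oplus>\<^bsub>FG\<^esub> b \<in> carrier FG"
  by (auto simp: group_algebra_def)

lemma smult_FG_closed: "\<lbrakk>c \<in> carrier F; a \<in> carrier FG\<rbrakk> \<Longrightarrow> c \<odot>\<^bsub>FG\<^esub> a \<in> carrier FG"
  by (auto simp: group_algebra_def)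

lemma mult_FG_closed:
  assumes "a \<in> carrier FG" "b \<in> carrier FG"
  shows "a \<otimes>\<^bsub>FG\<^esub> b \<in> carrier FG"
proof -
  have "(\<Oplus>\<^bsub>F\<^esub>y\<in>carrier G. a y \<otimes>\<^bsub>F\<^esub> b (inv y \<otimes> x)) \<in> carrier F" if "x \<in> carrier G" for x
    using assms that by (intro F.finsum_closed) auto
  then show ?thesis by (simp add: group_algebra_def)
qed

lemma abelian_group_FG: "abelian_group FG"
proof (rule abelian_groupI)
  fix a assume a: "a \<in> carrier FG"
  let ?b = "\<lambda>x\<in>carrier G. \<ominus>\<^bsub>F\<^esub> a x"
  have b: "?b \<in> carrier FG" using a by auto
  moreover have "?b \<oplus>\<^bsub>FG\<^esub> a = \<zero>\<^bsub>FG\<^esub>"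
    using a b add_FG_closed FG_apply_closed by (intro FG_eqI) (auto simp: add_apply F.l_neg)
  ultimately show "\<exists>y\<in>carrier FG. y \<oplus>\<^bsub>FG\<^esub> a = \<zero>\<^bsub>FG\<^esub>" by blast
next
  fix a b c assume "a \<in> carrier FG" "b \<in> carrier FG" "c \<in> carrier FG"
  then show "a \<oplus>\<^bsub>FG\<^esub> b \<oplus>\<^bsub>FG\<^esub> c = a \<oplus>\<^bsub>FG\<^esub> (b \<oplus>\<^bsub>FG\<^esub> c)"
    using FG_apply_closed by (intro FG_eqI add_FG_closed) (auto simp: add_apply F.a_assoc)
next
  fix a b assume "a \<in> carrier FG" "b \<in> carrier FG"
  then show "a \<oplus>\<^bsub>FG\<^esub> b = b \<oplus>\<^bsub>FG\<^esub> a"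
    using FG_apply_closed by (intro FG_eqI add_FG_closed) (auto simp: add_apply F.a_comm)
next
  fix a assume a: "a \<in> carrier FG"
  then show "\<zero>\<^bsub>FG\<^esub> \<oplus>\<^bsub>FG\<^esub> a = a"
    using FG_apply_closed[OF a] by (intro FG_eqI add_FG_closed) (auto simp: add_apply)
qed (auto simp: group_algebra_def)

text \<open>Left translation by \<open>z\<close> is injective, hence a permutation of the finite
  group.\<close>

lemma finsum_translate:
  assumes "z \<in> carrier G" "f \<in> carrier G \<rightarrow> carrier F"
  shows "(\<Oplus>\<^bsub>F\<^esub>y\<in>carrier G. f (z \<otimes> y)) = (\<Oplus>\<^bsub>F\<^esub>y\<in>carrier G. f y)"
proof -
  have inj: "inj_on (\<lambda>y. z \<otimes> y) (carrier G)" using assms(1) by (simp add: inj_on_def)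
  have "(\<lambda>y. z \<otimes> y) ` carrier G = carrier G"
    using assms(1) by (intro endo_inj_surj[OF finite_G _ inj]) auto
  then show ?thesis using F.finsum_reindex[of f "\<lambda>y. z \<otimes> y" "carrier G"] assms inj by simp
qed

text \<open>Expand the left side to a double sum and exchange the summations. Substituting
  \<open>y \<otimes> z\<close> for \<open>z\<close> then turns the inner sum into the convolution of
  \<open>b\<close> and \<open>c\<close>.\<close>

lemma mult_FG_assoc:
  assumes a: "a \<in> carrier FG" and b: "b \<in> carrier FG" and c: "c \<in> carrier FG"
  shows "a \<otimes>\<^bsub>FG\<^esub> b \<otimes>\<^bsub>FG\<^esub> c = a \<otimes>\<^bsub>FG\<^esub> (b \<otimes>\<^bsub>FG\<^esub> c)"
proof (rule FG_eqI)
  fix x assume x: "x \<in> carrier G"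
  note cl = FG_apply_closed[OF a] FG_apply_closed[OF b] FG_apply_closed[OF c]
  have "(a \<otimes>\<^bsub>FG\<^esub> b \<otimes>\<^bsub>FG\<^esub> c) x =
      (\<Oplus>\<^bsub>F\<^esub>z\<in>carrier G. (\<Oplus>\<^bsub>F\<^esub>y\<in>carrier G. a y \<otimes>\<^bsub>F\<^esub> b (inv y \<otimes> z)) \<otimes>\<^bsub>F\<^esub> c (inv z \<otimes> x))"
    using x cl by (simp add: mult_apply[OF x])
      (intro F.finsum_cong', auto simp: mult_apply intro!: F.finsum_closed)
  also have "\<dots> = (\<Oplus>\<^bsub>F\<^esub>z\<in>carrier G. \<Oplus>\<^bsub>F\<^esub>y\<in>carrier G. a y \<otimes>\<^bsub>F\<^esub> (b (inv y \<otimes> z) \<otimes>\<^bsub>F\<^esub> c (inv z \<otimes> x)))"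
  proof (rule F.finsum_cong')
    fix z assume z: "z \<in> carrier G"
    have "(\<Oplus>\<^bsub>F\<^esub>y\<in>carrier G. a y \<otimes>\<^bsub>F\<^esub> b (inv y \<otimes> z)) \<otimes>\<^bsub>F\<^esub> c (inv z \<otimes> x) =
        (\<Oplus>\<^bsub>F\<^esub>y\<in>carrier G. a y \<otimes>\<^bsub>F\<^esub> b (inv y \<otimes> z) \<otimes>\<^bsub>F\<^esub> c (inv z \<otimes> x))"
      using x z cl finite_G by (intro F.finsum_ldistr) auto
    also have "\<dots> = (\<Oplus>\<^bsub>F\<^esub>y\<in>carrier G. a y \<otimes>\<^bsub>F\<^esub> (b (inv y \<otimes> z) \<otimes>\<^bsub>F\<^esub> c (inv z \<otimes> x)))"
      using x z cl by (intro F.finsum_cong') (auto simp: F.m_assoc)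
    finally show "(\<Oplus>\<^bsub>F\<^esub>y\<in>carrier G. a y \<otimes>\<^bsub>F\<^esub> b (inv y \<otimes> z)) \<otimes>\<^bsub>F\<^esub> c (inv z \<otimes> x) =
        (\<Oplus>\<^bsub>F\<^esub>y\<in>carrier G. a y \<otimes>\<^bsub>F\<^esub> (b (inv y \<otimes> z) \<otimes>\<^bsub>F\<^esub> c (inv z \<otimes> x)))" .
  qed (use x cl in \<open>auto intro!: F.finsum_closed\<close>)
  also have "\<dots> = (\<Oplus>\<^bsub>F\<^esub>y\<in>carrier G. \<Oplus>\<^bsub>F\<^esub>z\<in>carrier G. a y \<otimes>\<^bsub>F\<^esub> (b (inv y \<otimes> z) \<otimes>\<^bsub>F\<^esub> c (inv z \<otimes> x)))"
    using x cl finite_G by (intro F.finsum_swap) auto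
  also have "\<dots> = (\<Oplus>\<^bsub>F\<^esub>y\<in>carrier G. a y \<otimes>\<^bsub>F\<^esub> (b \<otimes>\<^bsub>FG\<^esub> c) (inv y \<otimes> x))"
  proof (rule F.finsum_cong')
    fix y assume y: "y \<in> carrier G"
    have "(\<Oplus>\<^bsub>F\<^esub>z\<in>carrier G. a y \<otimes>\<^bsub>F\<^esub> (b (inv y \<otimes> z) \<otimes>\<^bsub>F\<^esub> c (inv z \<otimes> x))) =
        (\<Oplus>\<^bsub>F\<^esub>z\<in>carrier G. a y \<otimes>\<^bsub>F\<^esub> (b (inv y \<otimes> (y \<otimes> z)) \<otimes>\<^bsub>F\<^esub> c (inv (y \<otimes> z) \<otimes> x)))"
      using x y cl by (intro finsum_translate[symmetric]) auto
    also have "\<dots> = (\<Oplus>\<^bsub>F\<^esub>z\<in>carrier G. a y \<otimes>\<^bsub>F\<^esub> (b z \<otimes>\<^bsub>F\<^esub> c (inv z \<otimes> (inv y \<otimes> x))))"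
      using x y cl by (intro F.finsum_cong')
        (auto simp: G.inv_mult_group G.m_assoc simp flip: G.m_assoc[of "inv y" y])
    also have "\<dots> = a y \<otimes>\<^bsub>F\<^esub> (\<Oplus>\<^bsub>F\<^esub>z\<in>carrier G. b z \<otimes>\<^bsub>F\<^esub> c (inv z \<otimes> (inv y \<otimes> x)))"
      using x y cl finite_G by (intro F.finsum_rdistr[symmetric]) auto
    finally show "(\<Oplus>\<^bsub>F\<^esub>z\<in>carrier G. a y \<otimes>\<^bsub>F\<^esub> (b (inv y \<otimes> z) \<otimes>\<^bsub>F\<^esub> c (inv z \<otimes> x))) =
        a y \<otimes>\<^bsub>F\<^esub> (b \<otimes>\<^bsub>FG\<^esub> c) (inv y \<otimes> x)"
      using x y by (simp add: mult_apply)
  qed (use x cl mult_FG_closed[OF b c] FG_apply_closed in \<open>auto intro!: F.m_closed\<close>)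
  finally show "(a \<otimes>\<^bsub>FG\<^esub> b \<otimes>\<^bsub>FG\<^esub> c) x = (a \<otimes>\<^bsub>FG\<^esub> (b \<otimes>\<^bsub>FG\<^esub> c)) x"
    using x by (simp add: mult_apply)
qed (intro mult_FG_closed a b c)+

lemma ring_FG: "ring FG"
proof (rule ringI[OF abelian_group_FG])
  show "Group.monoid FG"
  proof (rule monoidI)
    fix a assume a: "a \<in> carrier FG"
    note cl = FG_apply_closed[OF a]
    show "\<one>\<^bsub>FG\<^esub> \<otimes>\<^bsub>FG\<^esub> a = a"
    proof (rule FG_eqI)
      fix x assume x: "x \<in> carrier G"
      have "(\<one>\<^bsub>FG\<^esub> \<otimes>\<^bsub>FG\<^esub> a) x = (\<Oplus>\<^bsub>F\<^esub>y\<in>carrier G. if \<one> = y then a (inv y \<otimes> x) else \<zero>\<^bsub>F\<^esub>)"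
        unfolding mult_apply[OF x] using x cl by (intro F.finsum_cong') (auto simp: one_apply)
      also have "\<dots> = a (inv \<one> \<otimes> x)" using x cl finite_G by (intro F.finsum_singleton) auto
      finally show "(\<one>\<^bsub>FG\<^esub> \<otimes>\<^bsub>FG\<^esub> a) x = a x" using x by simp
    qed (intro mult_FG_closed one_FG_closed a)+
    show "a \<otimes>\<^bsub>FG\<^esub> \<one>\<^bsub>FG\<^esub> = a"
    proof (rule FG_eqI)
      fix x assume x: "x \<in> carrier G"
      have *: "inv y \<otimes> x = \<one> \<longleftrightarrow> x = y" if "y \<in> carrier G" for y
        using x that by (metis G.inv_closed G.inv_equality G.inv_inv G.l_inv)
      have "(a \<otimes>\<^bsub>FG\<^esub> \<one>\<^bsub>FG\<^esub>) x = (\<Oplus>\<^bsub>F\<^esub>y\<in>carrier G. if x = y then a y else \<zero>\<^bsub>F\<^esub>)"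
        unfolding mult_apply[OF x] using x cl by (intro F.finsum_cong') (auto simp: one_apply *)
      also have "\<dots> = a x" using x cl finite_G by (intro F.finsum_singleton) auto
      finally show "(a \<otimes>\<^bsub>FG\<^esub> \<one>\<^bsub>FG\<^esub>) x = a x" .
    qed (intro mult_FG_closed one_FG_closed a)+
  qed (intro mult_FG_closed one_FG_closed mult_FG_assoc; assumption)+
next
  fix a b c assume abc: "a \<in> carrier FG" "b \<in> carrier FG" "c \<in> carrier FG"
  note cl = FG_apply_closed[OF abc(1)] FG_apply_closed[OF abc(2)] FG_apply_closed[OF abc(3)]
  show "(a \<oplus>\<^bsub>FG\<^esub> b) \<otimes>\<^bsub>FG\<^esub> c = a \<otimes>\<^bsub>FG\<^esub> c \<oplus>\<^bsub>FG\<^esub> b \<otimes>\<^bsub>FG\<^esub> c"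
  proof (rule FG_eqI)
    fix x assume x: "x \<in> carrier G"
    have "((a \<oplus>\<^bsub>FG\<^esub> b) \<otimes>\<^bsub>FG\<^esub> c) x =
        (\<Oplus>\<^bsub>F\<^esub>y\<in>carrier G. a y \<otimes>\<^bsub>F\<^esub> c (inv y \<otimes> x) \<oplus>\<^bsub>F\<^esub> b y \<otimes>\<^bsub>F\<^esub> c (inv y \<otimes> x))"
      unfolding mult_apply[OF x] using x cl
      by (intro F.finsum_cong') (auto simp: add_apply F.l_distr)
    also have "\<dots> = (a \<otimes>\<^bsub>FG\<^esub> c \<oplus>\<^bsub>FG\<^esub> b \<otimes>\<^bsub>FG\<^esub> c) x"
      unfolding add_apply[OF x] mult_apply[OF x] using x cl by (intro F.finsum_addf) auto
    finally show "((a \<oplus>\<^bsub>FG\<^esub> b) \<otimes>\<^bsub>FG\<^esub> c) x = (a \<otimes>\<^bsub>FG\<^esub> c \<oplus>\<^bsub>FG\<^esub> b \<otimes>\<^bsub>FG\<^esub> c) x" .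
  qed (intro mult_FG_closed add_FG_closed abc)+
  show "c \<otimes>\<^bsub>FG\<^esub> (a \<oplus>\<^bsub>FG\<^esub> b) = c \<otimes>\<^bsub>FG\<^esub> a \<oplus>\<^bsub>FG\<^esub> c \<otimes>\<^bsub>FG\<^esub> b"
  proof (rule FG_eqI)
    fix x assume x: "x \<in> carrier G"
    have "(c \<otimes>\<^bsub>FG\<^esub> (a \<oplus>\<^bsub>FG\<^esub> b)) x =
        (\<Oplus>\<^bsub>F\<^esub>y\<in>carrier G. c y \<otimes>\<^bsub>F\<^esub> a (inv y \<otimes> x) \<oplus>\<^bsub>F\<^esub> c y \<otimes>\<^bsub>F\<^esub> b (inv y \<otimes> x))"
      unfolding mult_apply[OF x] using x cl
      by (intro F.finsum_cong') (auto simp: add_apply F.r_distr)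
    also have "\<dots> = (c \<otimes>\<^bsub>FG\<^esub> a \<oplus>\<^bsub>FG\<^esub> c \<otimes>\<^bsub>FG\<^esub> b) x"
      unfolding add_apply[OF x] mult_apply[OF x] using x cl by (intro F.finsum_addf) auto
    finally show "(c \<otimes>\<^bsub>FG\<^esub> (a \<oplus>\<^bsub>FG\<^esub> b)) x = (c \<otimes>\<^bsub>FG\<^esub> a \<oplus>\<^bsub>FG\<^esub> c \<otimes>\<^bsub>FG\<^esub> b) x" .
  qed (intro mult_FG_closed add_FG_closed abc)+
qed

lemma module_FG: "module F FG"
proof (rule moduleI[OF F.is_cring abelian_group_FG])
  fix c d a assume h: "c \<in> carrier F" "d \<in> carrier F" "a \<in> carrier FG"
  note cl = FG_apply_closed[OF h(3)]
  show "(c \<oplus>\<^bsub>F\<^esub> d) \<odot>\<^bsub>FG\<^esub> a = c \<odot>\<^bsub>FG\<^esub> a \<oplus>\<^bsub>FG\<^esub> d \<odot>\<^bsub>FG\<^esub> a"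
    using h by (intro FG_eqI smult_FG_closed add_FG_closed)
      (auto simp: add_apply smult_apply F.l_distr cl)
  show "(c \<otimes>\<^bsub>F\<^esub> d) \<odot>\<^bsub>FG\<^esub> a = c \<odot>\<^bsub>FG\<^esub> (d \<odot>\<^bsub>FG\<^esub> a)"
    using h by (intro FG_eqI smult_FG_closed) (auto simp: smult_apply F.m_assoc cl)
next
  fix c a b assume h: "c \<in> carrier F" "a \<in> carrier FG" "b \<in> carrier FG"
  note cl = FG_apply_closed[OF h(2)] FG_apply_closed[OF h(3)]
  show "c \<odot>\<^bsub>FG\<^esub> (a \<oplus>\<^bsub>FG\<^esub> b) = c \<odot>\<^bsub>FG\<^esub> a \<oplus>\<^bsub>FG\<^esub> c \<odot>\<^bsub>FG\<^esub> b"
    using h by (intro FG_eqI smult_FG_closed add_FG_closed)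
      (auto simp: add_apply smult_apply F.r_distr cl)
next
  fix a assume a: "a \<in> carrier FG"
  then show "\<one>\<^bsub>F\<^esub> \<odot>\<^bsub>FG\<^esub> a = a"
    using FG_apply_closed[OF a] by (intro FG_eqI smult_FG_closed) (auto simp: smult_apply)
qed (rule smult_FG_closed)

lemma
  assumes "c \<in> carrier F" "a \<in> carrier FG" "b \<in> carrier FG"
  shows smult_mult_FG: "(c \<odot>\<^bsub>FG\<^esub> a) \<otimes>\<^bsub>FG\<^esub> b = c \<odot>\<^bsub>FG\<^esub> (a \<otimes>\<^bsub>FG\<^esub> b)" (is ?l)
    and mult_smult_FG: "a \<otimes>\<^bsub>FG\<^esub> (c \<odot>\<^bsub>FG\<^esub> b) = c \<odot>\<^bsub>FG\<^esub> (a \<otimes>\<^bsub>FG\<^esub> b)" (is ?r)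
proof -
  note cl = FG_apply_closed[OF assms(2)] FG_apply_closed[OF assms(3)] assms(1)
  show ?l
  proof (rule FG_eqI)
    fix x assume x: "x \<in> carrier G"
    have "(c \<odot>\<^bsub>FG\<^esub> (a \<otimes>\<^bsub>FG\<^esub> b)) x = (\<Oplus>\<^bsub>F\<^esub>y\<in>carrier G. c \<otimes>\<^bsub>F\<^esub> (a y \<otimes>\<^bsub>F\<^esub> b (inv y \<otimes> x)))"
      unfolding smult_apply[OF x] mult_apply[OF x]
      using x cl finite_G by (intro F.finsum_rdistr) auto
    also have "\<dots> = ((c \<odot>\<^bsub>FG\<^esub> a) \<otimes>\<^bsub>FG\<^esub> b) x"
      unfolding mult_apply[OF x] using x cl
      by (intro F.finsum_cong') (auto simp: smult_apply F.m_assoc)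
    finally show "((c \<odot>\<^bsub>FG\<^esub> a) \<otimes>\<^bsub>FG\<^esub> b) x = (c \<odot>\<^bsub>FG\<^esub> (a \<otimes>\<^bsub>FG\<^esub> b)) x" by simp
  qed (intro mult_FG_closed smult_FG_closed assms)+
  show ?r
  proof (rule FG_eqI)
    fix x assume x: "x \<in> carrier G"
    have "(c \<odot>\<^bsub>FG\<^esub> (a \<otimes>\<^bsub>FG\<^esub> b)) x = (\<Oplus>\<^bsub>F\<^esub>y\<in>carrier G. c \<otimes>\<^bsub>F\<^esub> (a y \<otimes>\<^bsub>F\<^esub> b (inv y \<otimes> x)))"
      unfolding smult_apply[OF x] mult_apply[OF x]
      using x cl finite_G by (intro F.finsum_rdistr) auto
    also have "\<dots> = (a \<otimes>\<^bsub>FG\<^esub> (c \<odot>\<^bsub>FG\<^esub> b)) x"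
      unfolding mult_apply[OF x] using x cl
      by (intro F.finsum_cong') (auto simp: smult_apply F.m_lcomm)
    finally show "(a \<otimes>\<^bsub>FG\<^esub> (c \<odot>\<^bsub>FG\<^esub> b)) x = (c \<odot>\<^bsub>FG\<^esub> (a \<otimes>\<^bsub>FG\<^esub> b)) x" by simp
  qed (intro mult_FG_closed smult_FG_closed assms)+
qed


section \<open>Sums over subgroups and their normalisations\<close>

lemma set_sum_eq:
  assumes "A \<subseteq> carrier G"
  shows "set_sum F G A = (\<lambda>x\<in>carrier G. if x \<in> A then \<one>\<^bsub>F\<^esub> else \<zero>\<^bsub>F\<^esub>)"
proof -
  interpret FG: ring FG by (rule ring_FG)
  have el: "group_elem F G g \<in> carrier FG" for g
    by (auto simp: group_elem_def)
  have "finite A" using assms finite_G by (rule finite_subset)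
  then show ?thesis using assms
  proof (induction A rule: finite_induct)
    case empty
    then show ?case by (auto simp: set_sum_def)
  next
    case (insert g A)
    have "set_sum F G (insert g A) = group_elem F G g \<oplus>\<^bsub>FG\<^esub> set_sum F G A"
      unfolding set_sum_def using insert el by (intro FG.finsum_insert) auto
    then show ?case using insert
      by (auto simp: add_apply group_elem_def fun_eq_iff group_algebra_def)
  qed
qed

lemma set_sum_closed: "A \<subseteq> carrier G \<Longrightarrow> set_sum F G A \<in> carrier FG"
  by (auto simp: set_sum_eq)

text \<open>If \<open>x = h k\<close>, its factorisations are \<open>(h z) (inv z k)\<close> with
  \<open>z\<close> in \<open>H \<inter> K\<close>, so all fibres of the multiplication map onto
  \<open>H <#> K\<close> have the same size. The product formula counts the pairs
  \<open>(y, x)\<close> with \<open>inv y \<otimes> x\<close> in \<open>K\<close> in two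
  ways.\<close>

lemma
  assumes H: "subgroup H G" and K: "subgroup K G"
  shows card_fibre_set_mult: "x \<in> H <#> K \<Longrightarrow> card {y \<in> H. inv y \<otimes> x \<in> K} = card (H \<inter> K)"
    and card_set_mult: "card (H <#> K) * card (H \<inter> K) = card H * card K"
proof -
  have HG: "h \<in> carrier G" if "h \<in> H" for h using subgroup.mem_carrier[OF H that] .
  have KG: "k \<in> carrier G" if "k \<in> K" for k using subgroup.mem_carrier[OF K that] .
  have fin: "finite H" "finite K"
    using HG KG finite_G by (auto intro: finite_subset[of _ "carrier G"])
  show *: "card {y \<in> H. inv y \<otimes> x \<in> K} = card (H \<inter> K)" if x: "x \<in> H <#> K" for x
  proof -
    obtain h k where hk: "h \<in> H" "k \<in> K" "x = h \<otimes> k"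
      using x by (auto simp: set_mult_def)
    have "{y \<in> H. inv y \<otimes> x \<in> K} = (\<lambda>z. h \<otimes> z) ` (H \<inter> K)"
    proof (intro equalityI subsetI)
      fix y assume "y \<in> {y \<in> H. inv y \<otimes> x \<in> K}"
      then have y: "y \<in> H" "inv y \<otimes> x \<in> K" by auto
      have "x \<otimes> inv k = h" using hk HG KG by (simp add: G.m_assoc)
      then have "inv y \<otimes> h = (inv y \<otimes> x) \<otimes> inv k"
        using hk y HG KG by (simp add: G.m_assoc)
      then have "inv y \<otimes> h \<in> K"
        using y hk K by (simp add: subgroup.m_closed subgroup.m_inv_closed)
      then have "inv (inv y \<otimes> h) \<in> K" using K by (simp add: subgroup.m_inv_closed)
      then have "inv h \<otimes> y \<in> K" using hk y HG by (simp add: G.inv_mult_group)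
      moreover have "inv h \<otimes> y \<in> H"
        using hk y H by (simp add: subgroup.m_closed subgroup.m_inv_closed)
      moreover have "y = h \<otimes> (inv h \<otimes> y)" using hk y HG by (simp flip: G.m_assoc)
      ultimately show "y \<in> (\<lambda>z. h \<otimes> z) ` (H \<inter> K)" by blast
    next
      fix y assume "y \<in> (\<lambda>z. h \<otimes> z) ` (H \<inter> K)"
      then obtain z where z: "z \<in> H" "z \<in> K" "y = h \<otimes> z" by auto
      have "inv h \<otimes> (h \<otimes> k) = k" using hk HG KG by (simp flip: G.m_assoc)
      then have "inv y \<otimes> x = inv z \<otimes> k"
        using hk z HG KG by (simp add: G.inv_mult_group G.m_assoc)
      then show "y \<in> {y \<in> H. inv y \<otimes> x \<in> K}"
        using hk z H K by (simp add: subgroup.m_closed subgroup.m_inv_closed)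
    qed
    moreover have "inj_on (\<lambda>z. h \<otimes> z) (H \<inter> K)"
      using hk HG by (auto simp: inj_on_def)
    ultimately show ?thesis by (simp add: card_image)
  qed
  \<comment> \<open>The second count: for fixed \<open>y\<close> the admissible \<open>x\<close>
    form the coset of \<open>K\<close> through \<open>y\<close>.\<close>
  have "card {x \<in> H <#> K. inv y \<otimes> x \<in> K} = card K" if y: "y \<in> H" for y
  proof -
    have "{x \<in> H <#> K. inv y \<otimes> x \<in> K} = (\<lambda>k. y \<otimes> k) ` K"
    proof (intro equalityI subsetI)
      fix x assume "x \<in> {x \<in> H <#> K. inv y \<otimes> x \<in> K}"
      then have x: "x \<in> H <#> K" "inv y \<otimes> x \<in> K" by auto
      have "x \<in> carrier G" using x(1) HG KG by (auto simp: set_mult_def)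
      then have "x = y \<otimes> (inv y \<otimes> x)" using y HG by (simp flip: G.m_assoc)
      then show "x \<in> (\<lambda>k. y \<otimes> k) ` K" using x by blast
    next
      fix x assume "x \<in> (\<lambda>k. y \<otimes> k) ` K"
      then obtain k where k: "k \<in> K" "x = y \<otimes> k" by auto
      have "inv y \<otimes> x = k" using k y HG KG by (simp flip: G.m_assoc)
      then show "x \<in> {x \<in> H <#> K. inv y \<otimes> x \<in> K}"
        using k y by (auto simp: set_mult_def)
    qed
    moreover have "inj_on (\<lambda>k. y \<otimes> k) K" using y HG KG by (auto simp: inj_on_def)
    ultimately show ?thesis by (simp add: card_image)
  qed
  moreover have "finite (H <#> K)" using fin by (simp add: set_mult_def)
  ultimately have "(\<Sum>x\<in>H <#> K. card {y \<in> H. inv y \<otimes> x \<in> K}) = card K * card H"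
    using fin by (intro sum_multicount) auto
  then show "card (H <#> K) * card (H \<inter> K) = card H * card K"
    using * by (simp add: mult.commute)
qed

text \<open>The coefficient of the convolution at \<open>x\<close> counts the factorisations of
  \<open>x\<close> over \<open>H\<close> and \<open>K\<close>: a full fibre inside
  \<open>H <#> K\<close>, none outside.\<close>

lemma set_sum_mult:
  assumes H: "subgroup H G" and K: "subgroup K G"
  shows "set_sum F G H \<otimes>\<^bsub>FG\<^esub> set_sum F G K =
    ([card (H \<inter> K)] \<cdot>\<^bsub>F\<^esub> \<one>\<^bsub>F\<^esub>) \<odot>\<^bsub>FG\<^esub> set_sum F G (H <#> K)"
proof (rule FG_eqI)
  have sub: "H \<subseteq> carrier G" "K \<subseteq> carrier G" "H <#> K \<subseteq> carrier G"
    using H K subgroup.subset G.set_mult_closed by blast+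
  show "set_sum F G H \<otimes>\<^bsub>FG\<^esub> set_sum F G K \<in> carrier FG"
    "([card (H \<inter> K)] \<cdot>\<^bsub>F\<^esub> \<one>\<^bsub>F\<^esub>) \<odot>\<^bsub>FG\<^esub> set_sum F G (H <#> K) \<in> carrier FG"
    using sub by (simp_all del: FG_simps add: mult_FG_closed smult_FG_closed set_sum_closed)
  fix x assume x: "x \<in> carrier G"
  have "(set_sum F G H \<otimes>\<^bsub>FG\<^esub> set_sum F G K) x =
      (\<Oplus>\<^bsub>F\<^esub>y\<in>carrier G. if y \<in> H \<and> inv y \<otimes> x \<in> K then \<one>\<^bsub>F\<^esub> else \<zero>\<^bsub>F\<^esub>)"
    unfolding mult_apply[OF x] using x sub by (intro F.finsum_cong') (auto simp: set_sum_eq)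
  also have "\<dots> = [card {y \<in> carrier G. y \<in> H \<and> inv y \<otimes> x \<in> K}] \<cdot>\<^bsub>F\<^esub> \<one>\<^bsub>F\<^esub>"
    using finite_G by (rule F.finsum_indicator)
  also have "{y \<in> carrier G. y \<in> H \<and> inv y \<otimes> x \<in> K} = {y \<in> H. inv y \<otimes> x \<in> K}"
    using sub by auto
  finally have *: "(set_sum F G H \<otimes>\<^bsub>FG\<^esub> set_sum F G K) x =
      [card {y \<in> H. inv y \<otimes> x \<in> K}] \<cdot>\<^bsub>F\<^esub> \<one>\<^bsub>F\<^esub>" .
  show "(set_sum F G H \<otimes>\<^bsub>FG\<^esub> set_sum F G K) x =
    (([card (H \<inter> K)] \<cdot>\<^bsub>F\<^esub> \<one>\<^bsub>F\<^esub>) \<odot>\<^bsub>FG\<^esub> set_sum F G (H <#> K)) x"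
  proof (cases "x \<in> H <#> K")
    case True
    then show ?thesis
      using * x sub card_fibre_set_mult[OF H K True] by (simp add: smult_apply set_sum_eq)
  next
    case False
    have "x = y \<otimes> (inv y \<otimes> x)" if "y \<in> H" for y
      using x sub that by (auto simp flip: G.m_assoc)
    then have "{y \<in> H. inv y \<otimes> x \<in> K} = {}"
      using False by (force simp: set_mult_def)
    then have "card {y \<in> H. inv y \<otimes> x \<in> K} = 0" by (simp only: card.empty)
    then show ?thesis using * x sub False by (simp add: smult_apply set_sum_eq)
  qed
qed

text \<open>A multiple of 1 vanishes exactly when the additive order of 1 divides the multiplier,
  also under the convention that an infinite order is 0. Lagrange passes from \<open>card H\<close>
  to the order of \<open>G\<close>.\<close>

lemma card_subgroup_nonzero:
  assumes "\<not> ring_char F dvd order G" "subgroup H G"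
  shows "[card H] \<cdot>\<^bsub>F\<^esub> \<one>\<^bsub>F\<^esub> \<noteq> \<zero>\<^bsub>F\<^esub>"
proof
  assume "[card H] \<cdot>\<^bsub>F\<^esub> \<one>\<^bsub>F\<^esub> = \<zero>\<^bsub>F\<^esub>"
  then have "ring_char F dvd card H"
    using group.pow_eq_id[OF F.a_group, of "\<one>\<^bsub>F\<^esub>" "card H"] by (simp add: ring_char_def add_pow_def)
  moreover have "card H dvd order G"
    using G.lagrange[OF assms(2)] by (metis dvd_triv_right)
  ultimately show False using assms(1) dvd_trans by blast
qed

text \<open>By \<open>set_sum_mult\<close> the product has coefficient |H \<inter> K| / (|H| |K|),
  which the product formula turns into 1 / |HK|. That \<open>H <#> K\<close> is a subgroup makes its
  order invertible in \<open>F\<close>.\<close>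

lemma hat_mult:
  assumes char: "\<not> ring_char F dvd order G"
    and H: "subgroup H G" and K: "subgroup K G" and HK: "subgroup (H <#> K) G"
  shows "hat F G H \<otimes>\<^bsub>FG\<^esub> hat F G K = hat F G (H <#> K)"
proof -
  interpret M: module F FG by (rule module_FG)
  define n where "n = (\<lambda>A::'g set. [card A] \<cdot>\<^bsub>F\<^esub> \<one>\<^bsub>F\<^esub>)"
  have n: "n A \<in> carrier F" for A by (simp add: n_def)
  have hat_n: "hat F G A = inv\<^bsub>F\<^esub> n A \<odot>\<^bsub>FG\<^esub> set_sum F G A" for A
    by (simp add: hat_def n_def)
  have mult_n: "set_sum F G H \<otimes>\<^bsub>FG\<^esub> set_sum F G K = n (H \<inter> K) \<odot>\<^bsub>FG\<^esub> set_sum F G (H <#> K)"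
    using set_sum_mult[OF H K] by (simp add: n_def)
  have unit: "n A \<in> Units F" if "subgroup A G" for A
    using card_subgroup_nonzero[OF char that] n by (simp add: F.field_Units n_def)
  have inv: "inv\<^bsub>F\<^esub> n A \<in> carrier F" if "subgroup A G" for A
    using unit[OF that] by (rule F.Units_inv_closed)
  have ss: "set_sum F G A \<in> carrier FG" if "subgroup A G" for A
    using that subgroup.subset set_sum_closed by blast
  have nn: "n (H <#> K) \<otimes>\<^bsub>F\<^esub> n (H \<inter> K) = n H \<otimes>\<^bsub>F\<^esub> n K"
    using card_set_mult[OF H K] by (simp add: n_def F.add_pow_ldistr F.add.nat_pow_pow mult.commute)
  have "inv\<^bsub>F\<^esub> n K \<otimes>\<^bsub>F\<^esub> inv\<^bsub>F\<^esub> n H \<otimes>\<^bsub>F\<^esub> n (H \<inter> K) = inv\<^bsub>F\<^esub> n (H <#> K)"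
  proof -
    let ?h = "inv\<^bsub>F\<^esub> n H" and ?k = "inv\<^bsub>F\<^esub> n K" and ?p = "inv\<^bsub>F\<^esub> n (H <#> K)"
    note cl = inv[OF H] inv[OF K] inv[OF HK] n
    have "?k \<otimes>\<^bsub>F\<^esub> ?h \<otimes>\<^bsub>F\<^esub> n (H \<inter> K) =
        (?p \<otimes>\<^bsub>F\<^esub> n (H <#> K)) \<otimes>\<^bsub>F\<^esub> (?k \<otimes>\<^bsub>F\<^esub> ?h \<otimes>\<^bsub>F\<^esub> n (H \<inter> K))"
      using cl unit[OF HK] by simp
    also have "\<dots> = ?p \<otimes>\<^bsub>F\<^esub> (?k \<otimes>\<^bsub>F\<^esub> ?h \<otimes>\<^bsub>F\<^esub> (n (H <#> K) \<otimes>\<^bsub>F\<^esub> n (H \<inter> K)))"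
      using cl by (simp add: F.m_ac)
    also have "\<dots> = ?p \<otimes>\<^bsub>F\<^esub> ((?h \<otimes>\<^bsub>F\<^esub> n H) \<otimes>\<^bsub>F\<^esub> (?k \<otimes>\<^bsub>F\<^esub> n K))"
      unfolding nn using cl by (simp add: F.m_ac)
    finally show ?thesis using cl unit[OF H] unit[OF K] by simp
  qed
  moreover have "hat F G H \<otimes>\<^bsub>FG\<^esub> hat F G K =
      (inv\<^bsub>F\<^esub> n K \<otimes>\<^bsub>F\<^esub> inv\<^bsub>F\<^esub> n H \<otimes>\<^bsub>F\<^esub> n (H \<inter> K)) \<odot>\<^bsub>FG\<^esub> set_sum F G (H <#> K)"
    unfolding hat_n
    using inv[OF H] inv[OF K] ss[OF H] ss[OF K] ss[OF HK] n
    by (simp del: FG_simps add: smult_mult_FG mult_smult_FG smult_FG_closed mult_FG_closed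
        mult_n M.smult_assoc1)
  ultimately show ?thesis by (simp add: hat_n)
qed

lemma hat_trivial: "hat F G {\<one>} = \<one>\<^bsub>FG\<^esub>"
proof -
  have "[Suc 0] \<cdot>\<^bsub>F\<^esub> \<one>\<^bsub>F\<^esub> = \<one>\<^bsub>F\<^esub>" by simp
  then show ?thesis by (auto simp: hat_def set_sum_eq group_algebra_def fun_eq_iff)
qed

lemma hat_closed:
  assumes "\<not> ring_char F dvd order G" "subgroup H G"
  shows "hat F G H \<in> carrier FG"
proof -
  have "[card H] \<cdot>\<^bsub>F\<^esub> \<one>\<^bsub>F\<^esub> \<in> Units F"
    using card_subgroup_nonzero[OF assms] by (simp add: F.field_Units)
  then show ?thesis
    unfolding hat_def using subgroup.subset[OF assms(2)]
    by (intro smult_FG_closed set_sum_closed F.Units_inv_closed)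
qed

text \<open>Allows the generators \<open>set_sum\<close> of the span to be replaced by the
  idempotents \<open>hat\<close>.\<close>

lemma set_sum_eq_smult_hat:
  assumes "\<not> ring_char F dvd order G" "subgroup H G"
  shows "set_sum F G H = ([card H] \<cdot>\<^bsub>F\<^esub> \<one>\<^bsub>F\<^esub>) \<odot>\<^bsub>FG\<^esub> hat F G H"
proof -
  interpret M: module F FG by (rule module_FG)
  have u: "[card H] \<cdot>\<^bsub>F\<^esub> \<one>\<^bsub>F\<^esub> \<in> Units F"
    using card_subgroup_nonzero[OF assms] by (simp add: F.field_Units)
  have s: "set_sum F G H \<in> carrier FG"
    using subgroup.subset[OF assms(2)] by (rule set_sum_closed)
  show ?thesis
    unfolding hat_def using s F.Units_inv_closed[OF u] F.Units_closed[OF u] F.Units_r_inv[OF u]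
    by (simp del: FG_simps flip: M.smult_assoc1)
qed

end

section \<open>The algebra of a semilattice of normal subgroups\<close>

locale normal_semilattice_algebra = finite_group_algebra +
  fixes \<L>
  assumes char_ndvd: "\<not> ring_char F dvd order G"
    and semilattice: "normal_semilattice G \<L>"
begin

lemma L_normal: "H \<in> \<L> \<Longrightarrow> H \<lhd> G"
  using semilattice by (simp add: normal_semilattice_def)

lemma L_subgroup: "H \<in> \<L> \<Longrightarrow> subgroup H G"
  using L_normal by (simp add: normal_imp_subgroup)

lemma L_set_mult: "\<lbrakk>H \<in> \<L>; K \<in> \<L>\<rbrakk> \<Longrightarrow> H <#> K \<in> \<L>"
  using semilattice by (simp add: normal_semilattice_def)

lemma L_bounds: "{\<one>} \<in> \<L>" "carrier G \<in> \<L>"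
  using semilattice by (simp_all add: normal_semilattice_def)

lemma L_hat_closed: "H \<in> \<L> \<Longrightarrow> hat F G H \<in> carrier FG"
  using hat_closed[OF char_ndvd] L_subgroup by blast

lemma L_hat_mult:
  assumes "H \<in> \<L>" "K \<in> \<L>"
  shows "hat F G H \<otimes>\<^bsub>FG\<^esub> hat F G K = hat F G (H <#> K)"
  using assms by (intro hat_mult char_ndvd L_subgroup L_set_mult)

text \<open>\<open>H <#> K = K <#> H\<close>, since \<open>K\<close> is normal.\<close>

lemma L_hat_commute:
  assumes "H \<in> \<L>" "K \<in> \<L>"
  shows "hat F G H \<otimes>\<^bsub>FG\<^esub> hat F G K = hat F G K \<otimes>\<^bsub>FG\<^esub> hat F G H"
  using assms G.commut_normal[OF L_subgroup L_normal, of H K] by (simp add: L_hat_mult)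

section \<open>The span as a commutative algebra\<close>

definition S where "S = carrier (semilattice_algebra F G \<L>)"

lemma semilattice_algebra_eq: "semilattice_algebra F G \<L> = FG\<lparr>carrier := S\<rparr>"
  by (simp add: S_def semilattice_algebra_def)

lemma submodule_S: "submodule F S FG"
proof -
  interpret M: module F FG by (rule module_FG)
  have "set_sum F G ` \<L> \<subseteq> carrier FG"
    using L_subgroup subgroup.subset set_sum_closed by blast
  then show ?thesis
    using M.span_is_submodule by (simp add: S_def semilattice_algebra_def)
qed

lemmas S_add = submodule.m_closed[OF submodule_S]
  and S_smult = submodule.smult_closed[OF submodule_S]
  and S_zero = submodule.zero_closed[OF submodule_S]

lemma S_subset: "S \<subseteq> carrier FG"
  using submodule_S by (rule submodule.subset)

lemma S_hat: "H \<in> \<L> \<Longrightarrow> hat F G H \<in> S"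
proof -
  assume H: "H \<in> \<L>"
  interpret M: module F FG by (rule module_FG)
  have "set_sum F G ` \<L> \<subseteq> carrier FG"
    using L_subgroup subgroup.subset set_sum_closed by blast
  then have "set_sum F G H \<in> S"
    using M.in_own_span[of "set_sum F G ` \<L>"] H by (auto simp: S_def semilattice_algebra_def)
  moreover have "[card H] \<cdot>\<^bsub>F\<^esub> \<one>\<^bsub>F\<^esub> \<in> Units F"
    using card_subgroup_nonzero[OF char_ndvd L_subgroup[OF H]] by (simp add: F.field_Units)
  ultimately show "hat F G H \<in> S"
    unfolding hat_def by (intro S_smult F.Units_inv_closed)
qed

text \<open>Each \<open>set_sum\<close> is a scalar multiple of its \<open>hat\<close>, so the base
  case may concern the \<open>hat\<close> elements, which multiply among themselves.\<close>

lemma S_induct [consumes 1, case_names zero add smult hat]: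
  assumes "x \<in> S"
    and "P \<zero>\<^bsub>FG\<^esub>"
    and "\<And>x y. \<lbrakk>x \<in> carrier FG; y \<in> carrier FG; P x; P y\<rbrakk> \<Longrightarrow> P (x \<oplus>\<^bsub>FG\<^esub> y)"
    and smult: "\<And>c x. \<lbrakk>c \<in> carrier F; x \<in> carrier FG; P x\<rbrakk> \<Longrightarrow> P (c \<odot>\<^bsub>FG\<^esub> x)"
    and hat: "\<And>H. H \<in> \<L> \<Longrightarrow> P (hat F G H)"
  shows "P x"
proof -
  interpret M: module F FG by (rule module_FG)
  have "set_sum F G ` \<L> \<subseteq> carrier FG"
    using L_subgroup subgroup.subset set_sum_closed by blast
  moreover have "x \<in> M.span (set_sum F G ` \<L>)"
    using assms(1) by (simp add: S_def semilattice_algebra_def)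
  moreover have "P b" if b: "b \<in> set_sum F G ` \<L>" for b
  proof -
    obtain H where H: "H \<in> \<L>" "b = set_sum F G H" using b by blast
    then show ?thesis
      using set_sum_eq_smult_hat[OF char_ndvd L_subgroup] hat smult L_hat_closed by simp
  qed
  ultimately show ?thesis using assms(2-4) by (intro M.span_induct[of x _ P])
qed

text \<open>Bilinearity reduces the claim to generators, where \<open>L_hat_mult\<close> applies:
  first \<open>x\<close> varies against a fixed \<open>hat K\<close>, then \<open>y\<close>
  varies.\<close>

lemma S_mult:
  assumes x: "x \<in> S" and y: "y \<in> S"
  shows "x \<otimes>\<^bsub>FG\<^esub> y \<in> S"
proof -
  interpret FG: ring FG by (rule ring_FG)
  have *: "x \<otimes>\<^bsub>FG\<^esub> hat F G K \<in> S" if K: "K \<in> \<L>" for K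
    using x
  proof (induction rule: S_induct)
    case (hat H)
    then show ?case using K by (simp add: L_hat_mult L_set_mult S_hat)
  qed (use L_hat_closed[OF K] in
      \<open>simp_all del: FG_simps add: S_zero S_add S_smult FG.l_distr smult_mult_FG\<close>)
  have xc: "x \<in> carrier FG" using x S_subset by blast
  show ?thesis
    using y
    by (induction rule: S_induct)
      (use xc * in \<open>simp_all del: FG_simps add: S_zero S_add S_smult FG.r_distr mult_smult_FG\<close>)
qed

lemma S_commute:
  assumes x: "x \<in> S" and y: "y \<in> S"
  shows "x \<otimes>\<^bsub>FG\<^esub> y = y \<otimes>\<^bsub>FG\<^esub> x"
proof -
  interpret FG: ring FG by (rule ring_FG)
  have *: "x \<otimes>\<^bsub>FG\<^esub> hat F G K = hat F G K \<otimes>\<^bsub>FG\<^esub> x" if K: "K \<in> \<L>" for K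
    using x
  proof (induction rule: S_induct)
    case (hat H)
    then show ?case using K by (rule L_hat_commute)
  qed (use L_hat_closed[OF K] in
      \<open>simp_all del: FG_simps add: FG.l_distr FG.r_distr smult_mult_FG mult_smult_FG\<close>)
  have xc: "x \<in> carrier FG" using x S_subset by blast
  show ?thesis
    using y
    by (induction rule: S_induct)
      (use xc * in \<open>simp_all del: FG_simps add: FG.l_distr FG.r_distr smult_mult_FG mult_smult_FG\<close>)
qed

lemma subcring_S: "subcring S FG"
proof -
  interpret FG: ring FG by (rule ring_FG)
  interpret M: module F FG by (rule module_FG)
  show ?thesis
  proof (intro FG.subcringI FG.subringI)
    show "\<one>\<^bsub>FG\<^esub> \<in> S" using S_hat[OF L_bounds(1)] by (simp add: hat_trivial)
    fix x assume x: "x \<in> S"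
    \<comment> \<open>As a scalar multiple, the negative stays in the submodule.\<close>
    then have "\<ominus>\<^bsub>FG\<^esub> x = (\<ominus>\<^bsub>F\<^esub> \<one>\<^bsub>F\<^esub>) \<odot>\<^bsub>FG\<^esub> x"
      using S_subset by (simp del: FG_simps add: M.smult_l_minus subsetD)
    then show "\<ominus>\<^bsub>FG\<^esub> x \<in> S" using x by (simp del: FG_simps add: S_smult)
  qed (use S_subset S_mult S_add S_commute in auto)
qed

text \<open>The locale \<open>algebra\<close> demands a commutative ring, which \<open>S\<close> is,
  although the group algebra around it need not be.\<close>

sublocale S: algebra F "FG\<lparr>carrier := S\<rparr>"
proof -
  interpret FG: ring FG by (rule ring_FG)
  interpret M: module F FG by (rule module_FG)
  interpret S: cring "FG\<lparr>carrier := S\<rparr>"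
    using subcring_S S_subset FG.subcring_iff by blast
  have "module F (FG\<lparr>carrier := S\<rparr>)"
    using submodule_S by (rule M.submodule_is_module)
  moreover have "algebra_axioms F (FG\<lparr>carrier := S\<rparr>)"
    using S_subset by unfold_locales (simp del: FG_simps add: smult_mult_FG subsetD)
  ultimately show "algebra F (FG\<lparr>carrier := S\<rparr>)"
    using S.cring_axioms by (simp add: algebra_def)
qed

text \<open>The product is the join for inclusion: it contains each factor because the other
  contains the identity, and a subgroup containing both factors contains all products.\<close>

sublocale L: idempotent_semilattice "FG\<lparr>carrier := S\<rparr>" \<L> "(<#>\<^bsub>G\<^esub>)" "{\<one>\<^bsub>G\<^esub>}" "carrier G" "hat F G"
proof (unfold_locales)
  fix H K assume H: "H \<in> \<L>" and K: "K \<in> \<L>"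
  have HK: "subgroup H G" "subgroup K G" using H K L_subgroup by auto
  show "H \<subseteq> H <#> K"
  proof
    fix h assume h: "h \<in> H"
    then have "h = h \<otimes> \<one>" using subgroup.mem_carrier[OF HK(1)] by simp
    then show "h \<in> H <#> K" using h subgroup.one_closed[OF HK(2)] unfolding set_mult_def by blast
  qed
  show "K \<subseteq> H <#> K"
  proof
    fix k assume k: "k \<in> K"
    then have "k = \<one> \<otimes> k" using subgroup.mem_carrier[OF HK(2)] by simp
    then show "k \<in> H <#> K" using k subgroup.one_closed[OF HK(1)] unfolding set_mult_def by blast
  qed
  show "hat F G H \<otimes>\<^bsub>FG\<lparr>carrier := S\<rparr>\<^esub> hat F G K = hat F G (H <#> K)"
    using H K by (simp add: L_hat_mult)
  fix M assume "M \<in> \<L>" "H \<subseteq> M" "K \<subseteq> M"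
  then show "H <#> K \<subseteq> M"
    using subgroup.m_closed[OF L_subgroup] by (auto simp: set_mult_def subset_iff)
next
  show "finite \<L>"
    using L_subgroup subgroup.subset finite_G
    by (intro finite_subset[of \<L> "Pow (carrier G)"]) auto
qed (use L_bounds L_set_mult S_hat hat_trivial L_subgroup[THEN subgroup.subset] in auto)

text \<open>\<open>eps\<close> subtracts and multiplies in the group algebra, \<open>L.e\<close> in
  \<open>S\<close>. As the factors lie in the commutative subring \<open>S\<close>, both operations
  can be carried over.\<close>

lemma eps_eq:
  assumes H: "H \<in> \<L>"
  shows "eps F G \<L> H = L.e H"
proof (cases "H = carrier G")
  case False
  interpret FG: ring FG by (rule ring_FG)
  have *: "hat F G H \<ominus>\<^bsub>FG\<^esub> hat F G M = hat F G H \<ominus>\<^bsub>FG\<lparr>carrier := S\<rparr>\<^esub> hat F G M" if "M \<in> \<L>" for M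
    using FG.a_inv_subring[OF subcring.axioms(1)[OF subcring_S] S_hat[OF that]]
    by (simp add: a_minus_def)
  then have "(\<Otimes>\<^bsub>FG\<^esub>M\<in>covers \<L> H. hat F G H \<ominus>\<^bsub>FG\<^esub> hat F G M) =
      (\<Otimes>\<^bsub>FG\<lparr>carrier := S\<rparr>\<^esub>M\<in>covers \<L> H. hat F G H \<ominus>\<^bsub>FG\<^esub> hat F G M)"
    using S.minus_closed[of "hat F G H"] S_hat H L.covers_L L.finite_covers
    by (intro FG.finprod_subcring[OF subcring_S]) auto
  also have "\<dots> = (\<Otimes>\<^bsub>FG\<lparr>carrier := S\<rparr>\<^esub>M\<in>covers \<L> H. hat F G H \<ominus>\<^bsub>FG\<lparr>carrier := S\<rparr>\<^esub> hat F G M)"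
    using * S.minus_closed[of "hat F G H"] S_hat H L.covers_L by (intro S.finprod_cong') auto
  finally show ?thesis using False by (simp add: eps_def L.e_def)
qed (simp add: eps_def L.e_def)

text \<open>The new point is \<open>E_scalar\<close>. On \<open>L.e H\<close> the generator
  \<open>hat K\<close> acts as 1 or 0 according to whether \<open>K \<subseteq> H\<close>, and
  acting by a scalar survives linear combinations.\<close>

sublocale split: split_idempotents F "FG\<lparr>carrier := S\<rparr>" L.E
proof unfold_locales
  show "(\<Oplus>\<^bsub>FG\<lparr>carrier := S\<rparr>\<^esub>e\<in>L.E. e) = \<one>\<^bsub>FG\<lparr>carrier := S\<rparr>\<^esub>" by (rule L.sum_E)
next
  fix x f assume x: "x \<in> carrier (FG\<lparr>carrier := S\<rparr>)" and "f \<in> L.E"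
  then obtain H where H: "H \<in> \<L>" "f = L.e H" by (auto simp: L.E_def)
  interpret FG: ring FG by (rule ring_FG)
  interpret M: module F FG by (rule module_FG)
  have f: "f \<in> carrier FG" using L.e_closed[OF H(1)] H(2) S_subset by auto
  have "x \<in> S" using x by simp
  then have "\<exists>c\<in>carrier F. x \<otimes>\<^bsub>FG\<^esub> f = c \<odot>\<^bsub>FG\<^esub> f"
  proof (induction rule: S_induct)
    case zero
    show ?case using f by (intro bexI[of _ "\<zero>\<^bsub>F\<^esub>"]) (simp_all del: FG_simps)
  next
    case (add x y)
    then obtain c d where "c \<in> carrier F" "d \<in> carrier F"
      "x \<otimes>\<^bsub>FG\<^esub> f = c \<odot>\<^bsub>FG\<^esub> f" "y \<otimes>\<^bsub>FG\<^esub> f = d \<odot>\<^bsub>FG\<^esub> f" by blast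
    then show ?case using add(1,2) f
      by (intro bexI[of _ "c \<oplus>\<^bsub>F\<^esub> d"]) (simp_all del: FG_simps add: FG.l_distr M.smult_l_distr)
  next
    case (smult b x)
    from smult(3) obtain c where "c \<in> carrier F" "x \<otimes>\<^bsub>FG\<^esub> f = c \<odot>\<^bsub>FG\<^esub> f" ..
    then show ?case using smult(1,2) f
      by (intro bexI[of _ "b \<otimes>\<^bsub>F\<^esub> c"]) (simp_all del: FG_simps add: smult_mult_FG M.smult_assoc1)
  next
    case (hat K)
    show ?case
    proof (cases "K \<subseteq> H")
      case True
      then have "hat F G K \<otimes>\<^bsub>FG\<^esub> f = f" using L.u_mult_e[OF hat H(1)] H(2) by simp
      then show ?thesis using f by (intro bexI[of _ "\<one>\<^bsub>F\<^esub>"]) (simp_all del: FG_simps)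
    next
      case False
      then have "hat F G K \<otimes>\<^bsub>FG\<^esub> f = \<zero>\<^bsub>FG\<^esub>"
        using L.u_mult_e_eq_zero[OF hat H(1)] H(2) by simp
      then show ?thesis using f by (intro bexI[of _ "\<zero>\<^bsub>F\<^esub>"]) (simp_all del: FG_simps)
    qed
  qed
  then show "\<exists>c\<in>carrier F. x \<otimes>\<^bsub>FG\<lparr>carrier := S\<rparr>\<^esub> f = c \<odot>\<^bsub>FG\<lparr>carrier := S\<rparr>\<^esub> f" by simp
qed (use L.finite_E L.e_closed L.e_idem L.e_orth in \<open>auto simp: L.E_def\<close>)

end

theorem theorem2p3:
  fixes G :: "('g, 'n) monoid_scheme"
    and F :: "('f, 'm) ring_scheme"
    and \<L> :: "'g set set"
  assumes "group G" and "finite (carrier G)"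
    and "field F" and "\<not> ring_char F dvd order G"
    and "normal_semilattice G \<L>"
  defines "E \<equiv> {eps F G \<L> H | H. H \<in> \<L> \<and> eps F G \<L> H \<noteq> \<zero>\<^bsub>group_algebra F G\<^esub>}"
  shows "E = primitive_central_idempotents (semilattice_algebra F G \<L>) \<and>
    algebra_isomorphic F (semilattice_algebra F G \<L>) (direct_power F (card E))"
proof -
  interpret normal_semilattice_algebra G F \<L>
    using assms by (simp add: normal_semilattice_algebra_def normal_semilattice_algebra_axioms_def
        finite_group_algebra_def finite_group_algebra_axioms_def)
  \<comment> \<open>On \<open>\<L>\<close> the elements \<open>eps\<close> and \<open>L.e\<close>
    agree, and the zero of \<open>S\<close> is that of the group algebra.\<close>
  have "E = L.E"
    unfolding E_def L.E_def by (auto simp: eps_eq)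
  then show ?thesis
    using split.primitive_central_idempotents_eq split.algebra_isomorphic_direct_power
    by (simp add: semilattice_algebra_eq)
qed

end
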